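(* Let $\Gamma$ be a discrete group and let $A$ be a unital separable C$^*$-algebra with connected unitary group. Let $q\colon\mathrm{Aut}(A)\to\mathrm{Out}(A)$ be the quotient homomorphism. The map $(\alpha,[u])\mapsto q\circ\alpha$ provides a natural isomorphism of pointed sets $$H^1(\Gamma,P\mathcal{G}_A)\cong\{\Gamma\text{-kernels of }A\}/\!\sim_c .$$ Similarly, if $\tau$ is a tracial state on $A$, then $(\alpha,[u])\mapsto q\circ\alpha$ provides a natural isomorphism of pointed sets $$H^1(\Gamma,P\mathcal{G}_A^\tau)\cong\{\tau\text{-preserving }\Gamma\text{-kernels of }A\}/\!\sim_{\tau.c}.$$
   Context: $\mathrm{Inn}(A)=\{\mathrm{Ad}_u:u\in U(A)\}$, $\mathrm{Ad}_u(a)=uau^*$, $\mathrm{Out}(A)=\mathrm{Aut}(A)/\mathrm{Inn}(A)$. A $\Gamma$-kernel on $A$ is a group homomorphism $\Gamma\to\mathrm{Out}(A)$; two $\Gamma$-kernels $\alpha,\beta$ are conjugate ($\alpha\sim_c\beta$) if there is $\varphi\in\mathrm{Aut}(A)$ with $\varphi\alpha_g\varphi^{-1}=\beta_g$ in $\mathrm{Out}(A)$ for all $g\in\Gamma$. A $\Gamma$-kernel is $\tau$-preserving if (lifts of) its values preserve $\tau$; two $\tau$-preserving $\Gamma$-kernels are $\tau$-conjugate ($\sim_{\tau.c}$) if they are conjugate via some $\varphi\in\mathrm{Aut}_\tau(A)=\{\varphi\in\mathrm{Aut}(A):\tau\circ\varphi=\tau\}$. The base point is the class of the trivial kernel. Let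 $PU(A)=U(A)/ZU(A)$, where $ZU(A)$ is the centre of $U(A)$. A crossed module is a continuous homomorphism of topological groups $\partial\colon H\to G$ with a continuous left action of $G$ on $H$ with $\partial(\alpha(u))=\alpha\partial(u)\alpha^{-1}$, $\partial(u)(v)=uvu^{-1}$. $P\mathcal{G}_A=(\mathrm{Ad}\colon PU(A)\to\mathrm{Aut}(A))$ and $P\mathcal{G}_A^\tau=(\mathrm{Ad}\colon PU(A)\to\mathrm{Aut}_\tau(A))$, with the natural action $\alpha([u])=[\alpha(u)]$. For a crossed module $\mathcal{G}=(\partial\colon H\to G)$, $Z^1(\Gamma,\mathcal{G})$ is the set of pairs $(\alpha\colon\Gamma\to G,\ u\colon\Gamma\times\Gamma\to H)$ with $\alpha_g\alpha_h=\partial(u_{g,h})\alpha_{gh}$ and $\alpha_g(u_{h,k})u_{g,hk}=u_{g,h}u_{gh,k}$; two pairs are cohomologous if there are $\gamma\in G$, $w\colon\Gamma\to H$ with $\alpha^{(1)}_g=\partial(w_g)\gamma\alpha^{(0)}_g\gamma^{-1}$ and $u^{(1)}_{g,h}=w_g\gamma(\alpha^{(0)}_g(\gamma^{-1}(w_h))u^{(0)}_{g,h})w_{gh}^{-1}$. $H^1(\Gamma,\mathcal{G})$ is the set of cohomology classes pointed by the trivial cocycle. Naturality is with respect to pullback along homomorphisms of $\Gamma$. *)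

theory Defs
  imports "HOL-Analysis.Analysis" "HOL-Algebra.Coset"
begin

section \<open>Unital C*-algebras\<close>

text \<open>
  The axiom \<open>0 \<noteq> 1\<close> is not imposed, so the zero algebra is included.  The real
  scalar multiplication inherited from the normed-space classes is the restriction of the
  complex one.
\<close>

class unital_cstar_algebra = real_normed_algebra + monoid_mult + banach +
  fixes scaleC :: "complex \<Rightarrow> 'a \<Rightarrow> 'a"
    and star :: "'a \<Rightarrow> 'a"
  assumes scaleC_add_right: "scaleC c (x + y) = scaleC c x + scaleC c y"
    and scaleC_add_left: "scaleC (c + d) x = scaleC c x + scaleC d x"
    and scaleC_scaleC: "scaleC c (scaleC d x) = scaleC (c * d) x"
    and scaleR_eq_scaleC: "scaleR r x = scaleC (complex_of_real r) x"
    and norm_scaleC: "norm (scaleC c x) = cmod c * norm x"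
    and mult_scaleC_left: "scaleC c x * y = scaleC c (x * y)"
    and mult_scaleC_right: "x * scaleC c y = scaleC c (x * y)"
    and star_star: "star (star x) = x"
    and star_add: "star (x + y) = star x + star y"
    and star_scaleC: "star (scaleC c x) = scaleC (cnj c) (star x)"
    and star_mult: "star (x * y) = star y * star x"
    and cstar_identity: "norm (star x * x) = (norm x)\<^sup>2"

definition unitary :: "'a::unital_cstar_algebra \<Rightarrow> bool" where
  "unitary u \<longleftrightarrow> star u * u = 1 \<and> u * star u = 1"

definition star_automorphism :: "('a::unital_cstar_algebra \<Rightarrow> 'a) \<Rightarrow> bool" where
  "star_automorphism \<phi> \<longleftrightarrow> bij \<phi>
     \<and> (\<forall>x y. \<phi> (x + y) = \<phi> x + \<phi> y)
     \<and> (\<forall>c x. \<phi> (scaleC c x) = scaleC c (\<phi> x))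
     \<and> (\<forall>x y. \<phi> (x * y) = \<phi> x * \<phi> y)
     \<and> (\<forall>x. \<phi> (star x) = star (\<phi> x))"

definition tracial_state :: "('a::unital_cstar_algebra \<Rightarrow> complex) \<Rightarrow> bool" where
  "tracial_state \<tau> \<longleftrightarrow>
     (\<forall>x y. \<tau> (x + y) = \<tau> x + \<tau> y)
     \<and> (\<forall>c x. \<tau> (scaleC c x) = c * \<tau> x)
     \<and> (\<forall>x. \<tau> (star x * x) \<in> \<real>\<^sub>\<ge>\<^sub>0)
     \<and> \<tau> 1 = 1
     \<and> (\<forall>x y. \<tau> (x * y) = \<tau> (y * x))"


section \<open>The groups \<open>U(A)\<close>, \<open>PU(A)\<close>, \<open>Aut(A)\<close> and \<open>Out(A)\<close>\<close>

text \<open>The algebra \<open>A\<close> is the type \<^typ>\<open>'a\<close>, so it enters the following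
  constants only through their types.\<close>

definition U_grp :: "'a::unital_cstar_algebra monoid" where
  "U_grp = \<lparr>carrier = {u. unitary u}, mult = (*), one = 1\<rparr>"

definition ZU :: "'a::unital_cstar_algebra set" where
  "ZU = {z \<in> carrier U_grp. \<forall>u \<in> carrier U_grp. z * u = u * z}"

definition PU :: "'a::unital_cstar_algebra set monoid" where
  "PU = U_grp Mod ZU"

definition Aut :: "('a::unital_cstar_algebra \<Rightarrow> 'a) monoid" where
  "Aut = \<lparr>carrier = {\<phi>. star_automorphism \<phi>}, mult = (\<circ>), one = id\<rparr>"

definition Aut_tr :: "('a::unital_cstar_algebra \<Rightarrow> complex) \<Rightarrow> ('a \<Rightarrow> 'a) monoid" where
  "Aut_tr \<tau> = Aut\<lparr>carrier := {\<phi> \<in> carrier Aut. \<tau> \<circ> \<phi> = \<tau>}\<rparr>"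

definition Ad :: "'a::unital_cstar_algebra \<Rightarrow> 'a \<Rightarrow> 'a" where
  "Ad u = (\<lambda>a. u * a * star u)"

definition Inn :: "('a::unital_cstar_algebra \<Rightarrow> 'a) set" where
  "Inn = Ad ` carrier U_grp"

definition Out :: "('a::unital_cstar_algebra \<Rightarrow> 'a) set monoid" where
  "Out = Aut Mod Inn"

definition quot_Out :: "('a::unital_cstar_algebra \<Rightarrow> 'a) \<Rightarrow> ('a \<Rightarrow> 'a) set" where
  "quot_Out \<phi> = Inn #>\<^bsub>Aut\<^esub> \<phi>"


section \<open>Kernels and conjugacy\<close>

text \<open>Maps out of a group are taken to be \<^const>\<open>extensional\<close>, so that two of them
  are equal as soon as they agree on the carrier.\<close>

definition kernels ::
    "('g, 'm) monoid_scheme \<Rightarrow> ('g \<Rightarrow> ('a::unital_cstar_algebra \<Rightarrow> 'a) set) set" where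
  "kernels \<Gamma> = hom \<Gamma> Out \<inter> extensional (carrier \<Gamma>)"

text \<open>The elements of \<open>\<kappa> g\<close> are exactly the lifts of \<open>\<kappa> g\<close> to \<open>Aut(A)\<close>; for a trace
  \<open>\<tau>\<close>, one of them preserves \<open>\<tau>\<close> if and only if all of them do.\<close>

definition kernels_tr ::
    "('g, 'm) monoid_scheme \<Rightarrow> ('a::unital_cstar_algebra \<Rightarrow> complex)
      \<Rightarrow> ('g \<Rightarrow> ('a \<Rightarrow> 'a) set) set" where
  "kernels_tr \<Gamma> \<tau> = {\<kappa> \<in> kernels \<Gamma>. \<forall>g \<in> carrier \<Gamma>. \<forall>\<phi> \<in> \<kappa> g. \<tau> \<circ> \<phi> = \<tau>}"

definition conjugates ::
    "('g, 'm) monoid_scheme \<Rightarrow> ('a::unital_cstar_algebra \<Rightarrow> 'a)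
      \<Rightarrow> ('g \<Rightarrow> ('a \<Rightarrow> 'a) set) \<Rightarrow> ('g \<Rightarrow> ('a \<Rightarrow> 'a) set) \<Rightarrow> bool" where
  "conjugates \<Gamma> \<phi> \<kappa> \<mu> \<longleftrightarrow> (\<forall>g \<in> carrier \<Gamma>.
     quot_Out \<phi> \<otimes>\<^bsub>Out\<^esub> \<kappa> g \<otimes>\<^bsub>Out\<^esub> inv\<^bsub>Out\<^esub> (quot_Out \<phi>) = \<mu> g)"

definition conj_rel ::
    "('g, 'm) monoid_scheme \<Rightarrow> ('g \<Rightarrow> ('a::unital_cstar_algebra \<Rightarrow> 'a) set) rel" where
  "conj_rel \<Gamma> = {(\<kappa>, \<mu>) \<in> kernels \<Gamma> \<times> kernels \<Gamma>. \<exists>\<phi> \<in> carrier Aut. conjugates \<Gamma> \<phi> \<kappa> \<mu>}"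

definition conj_rel_tr ::
    "('g, 'm) monoid_scheme \<Rightarrow> ('a::unital_cstar_algebra \<Rightarrow> complex)
      \<Rightarrow> ('g \<Rightarrow> ('a \<Rightarrow> 'a) set) rel" where
  "conj_rel_tr \<Gamma> \<tau> = {(\<kappa>, \<mu>) \<in> kernels_tr \<Gamma> \<tau> \<times> kernels_tr \<Gamma> \<tau>.
     \<exists>\<phi> \<in> carrier (Aut_tr \<tau>). conjugates \<Gamma> \<phi> \<kappa> \<mu>}"

definition trivial_kernel ::
    "('g, 'm) monoid_scheme \<Rightarrow> 'g \<Rightarrow> ('a::unital_cstar_algebra \<Rightarrow> 'a) set" where
  "trivial_kernel \<Gamma> = (\<lambda>g \<in> carrier \<Gamma>. \<one>\<^bsub>Out\<^esub>)"


section \<open>Crossed modules and their first cohomology\<close>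

definition topological_group :: "('a, 'm) monoid_scheme \<Rightarrow> 'a topology \<Rightarrow> bool" where
  "topological_group G T \<longleftrightarrow> group G \<and> topspace T = carrier G
     \<and> continuous_map (prod_topology T T) T (\<lambda>(x, y). x \<otimes>\<^bsub>G\<^esub> y)
     \<and> continuous_map T T (\<lambda>x. inv\<^bsub>G\<^esub> x)"

record ('h, 'g) xmod =
  dom_grp :: "'h monoid"
  cod_grp :: "'g monoid"
  dom_top :: "'h topology"
  cod_top :: "'g topology"
  bdry :: "'h \<Rightarrow> 'g"
  act :: "'g \<Rightarrow> 'h \<Rightarrow> 'h"

definition crossed_module :: "('h, 'g) xmod \<Rightarrow> bool" where
  "crossed_module X \<longleftrightarrow>
     topological_group (dom_grp X) (dom_top X)
     \<and> topological_group (cod_grp X) (cod_top X)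
     \<and> bdry X \<in> hom (dom_grp X) (cod_grp X)
     \<and> continuous_map (dom_top X) (cod_top X) (bdry X)
     \<and> (\<forall>a \<in> carrier (cod_grp X). act X a \<in> hom (dom_grp X) (dom_grp X))
     \<and> (\<forall>u \<in> carrier (dom_grp X). act X \<one>\<^bsub>cod_grp X\<^esub> u = u)
     \<and> (\<forall>a \<in> carrier (cod_grp X). \<forall>b \<in> carrier (cod_grp X). \<forall>u \<in> carrier (dom_grp X).
          act X (a \<otimes>\<^bsub>cod_grp X\<^esub> b) u = act X a (act X b u))
     \<and> continuous_map (prod_topology (cod_top X) (dom_top X)) (dom_top X) (\<lambda>(a, u). act X a u)
     \<and> (\<forall>a \<in> carrier (cod_grp X). \<forall>u \<in> carrier (dom_grp X).
          bdry X (act X a u) = a \<otimes>\<^bsub>cod_grp X\<^esub> bdry X u \<otimes>\<^bsub>cod_grp X\<^esub> inv\<^bsub>cod_grp X\<^esub> a)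
     \<and> (\<forall>u \<in> carrier (dom_grp X). \<forall>v \<in> carrier (dom_grp X).
          act X (bdry X u) v = u \<otimes>\<^bsub>dom_grp X\<^esub> v \<otimes>\<^bsub>dom_grp X\<^esub> inv\<^bsub>dom_grp X\<^esub> u)"

text \<open>The group \<open>\<Gamma>\<close> is discrete, so the topologies impose no condition on cocycles.\<close>

definition Z1 ::
    "('g, 'm) monoid_scheme \<Rightarrow> ('h, 'k) xmod \<Rightarrow> (('g \<Rightarrow> 'k) \<times> ('g \<times> 'g \<Rightarrow> 'h)) set" where
  "Z1 \<Gamma> X = {(\<alpha>, u).
     \<alpha> \<in> carrier \<Gamma> \<rightarrow>\<^sub>E carrier (cod_grp X)
     \<and> u \<in> carrier \<Gamma> \<times> carrier \<Gamma> \<rightarrow>\<^sub>E carrier (dom_grp X)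
     \<and> (\<forall>g \<in> carrier \<Gamma>. \<forall>h \<in> carrier \<Gamma>.
          \<alpha> g \<otimes>\<^bsub>cod_grp X\<^esub> \<alpha> h = bdry X (u (g, h)) \<otimes>\<^bsub>cod_grp X\<^esub> \<alpha> (g \<otimes>\<^bsub>\<Gamma>\<^esub> h))
     \<and> (\<forall>g \<in> carrier \<Gamma>. \<forall>h \<in> carrier \<Gamma>. \<forall>k \<in> carrier \<Gamma>.
          act X (\<alpha> g) (u (h, k)) \<otimes>\<^bsub>dom_grp X\<^esub> u (g, h \<otimes>\<^bsub>\<Gamma>\<^esub> k)
            = u (g, h) \<otimes>\<^bsub>dom_grp X\<^esub> u (g \<otimes>\<^bsub>\<Gamma>\<^esub> h, k))}"

definition cohomologous_via ::
    "('g, 'm) monoid_scheme \<Rightarrow> ('h, 'k) xmod \<Rightarrow> 'k \<Rightarrow> ('g \<Rightarrow> 'h)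
      \<Rightarrow> ('g \<Rightarrow> 'k) \<times> ('g \<times> 'g \<Rightarrow> 'h) \<Rightarrow> ('g \<Rightarrow> 'k) \<times> ('g \<times> 'g \<Rightarrow> 'h) \<Rightarrow> bool" where
  "cohomologous_via \<Gamma> X \<gamma> w = (\<lambda>(\<alpha>0, u0) (\<alpha>1, u1).
     (\<forall>g \<in> carrier \<Gamma>.
        \<alpha>1 g = bdry X (w g) \<otimes>\<^bsub>cod_grp X\<^esub> \<gamma> \<otimes>\<^bsub>cod_grp X\<^esub> \<alpha>0 g
                 \<otimes>\<^bsub>cod_grp X\<^esub> inv\<^bsub>cod_grp X\<^esub> \<gamma>)
     \<and> (\<forall>g \<in> carrier \<Gamma>. \<forall>h \<in> carrier \<Gamma>.
        u1 (g, h) =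
          w g \<otimes>\<^bsub>dom_grp X\<^esub>
          act X \<gamma> (act X (\<alpha>0 g) (act X (inv\<^bsub>cod_grp X\<^esub> \<gamma>) (w h)) \<otimes>\<^bsub>dom_grp X\<^esub> u0 (g, h))
          \<otimes>\<^bsub>dom_grp X\<^esub> inv\<^bsub>dom_grp X\<^esub> (w (g \<otimes>\<^bsub>\<Gamma>\<^esub> h))))"

definition cohom_rel ::
    "('g, 'm) monoid_scheme \<Rightarrow> ('h, 'k) xmod \<Rightarrow> (('g \<Rightarrow> 'k) \<times> ('g \<times> 'g \<Rightarrow> 'h)) rel" where
  "cohom_rel \<Gamma> X = {(c0, c1) \<in> Z1 \<Gamma> X \<times> Z1 \<Gamma> X.
     \<exists>\<gamma> \<in> carrier (cod_grp X). \<exists>w \<in> carrier \<Gamma> \<rightarrow> carrier (dom_grp X).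
       cohomologous_via \<Gamma> X \<gamma> w c0 c1}"

definition H1 ::
    "('g, 'm) monoid_scheme \<Rightarrow> ('h, 'k) xmod \<Rightarrow> (('g \<Rightarrow> 'k) \<times> ('g \<times> 'g \<Rightarrow> 'h)) set set" where
  "H1 \<Gamma> X = Z1 \<Gamma> X // cohom_rel \<Gamma> X"

definition trivial_cocycle ::
    "('g, 'm) monoid_scheme \<Rightarrow> ('h, 'k) xmod \<Rightarrow> ('g \<Rightarrow> 'k) \<times> ('g \<times> 'g \<Rightarrow> 'h)" where
  "trivial_cocycle \<Gamma> X =
     ((\<lambda>g \<in> carrier \<Gamma>. \<one>\<^bsub>cod_grp X\<^esub>), (\<lambda>p \<in> carrier \<Gamma> \<times> carrier \<Gamma>. \<one>\<^bsub>dom_grp X\<^esub>))"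


section \<open>The crossed modules of a C*-algebra\<close>

text \<open>\<open>U(A)\<close> has the norm topology and \<open>PU(A)\<close> the quotient topology; automorphism groups
  have the topology of pointwise norm convergence.\<close>

definition PU_top :: "'a::unital_cstar_algebra set topology" where
  "PU_top = topology (\<lambda>W. W \<subseteq> carrier PU \<and>
     openin (top_of_set (carrier U_grp)) {u \<in> carrier U_grp. ZU #>\<^bsub>U_grp\<^esub> u \<in> W})"

definition ptnorm_top :: "('a::unital_cstar_algebra \<Rightarrow> 'a) set \<Rightarrow> ('a \<Rightarrow> 'a) topology" where
  "ptnorm_top S = subtopology (product_topology (\<lambda>_. euclidean) UNIV) S"

text \<open>\<^const>\<open>Ad\<close> is constant on each coset of \<^const>\<open>ZU\<close>, and the boundary map takes this
  value.  The action \<open>\<alpha>([u]) = [\<alpha>(u)]\<close> is the direct image of cosets.\<close>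

definition PG :: "('a::unital_cstar_algebra set, 'a \<Rightarrow> 'a) xmod" where
  "PG = \<lparr>dom_grp = PU, cod_grp = Aut,
         dom_top = PU_top, cod_top = ptnorm_top (carrier Aut),
         bdry = (\<lambda>c. the_elem (Ad ` c)), act = (\<lambda>\<alpha> c. \<alpha> ` c)\<rparr>"

definition PG_tr ::
    "('a::unital_cstar_algebra \<Rightarrow> complex) \<Rightarrow> ('a set, 'a \<Rightarrow> 'a) xmod" where
  "PG_tr \<tau> = PG\<lparr>cod_grp := Aut_tr \<tau>, cod_top := ptnorm_top (carrier (Aut_tr \<tau>))\<rparr>"


section \<open>Induced maps on classes\<close>

text \<open>The map on classes induced by \<open>F\<close>: the class of \<open>x\<close> goes to the \<open>S\<close>-class of \<open>F x\<close>.
  It is meaningful on \<open>C\<close> only if this class is the same for all \<open>x \<in> C\<close>.\<close>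

definition induced :: "'y rel \<Rightarrow> ('x \<Rightarrow> 'y) \<Rightarrow> 'x set \<Rightarrow> 'y set" where
  "induced S F C = the_elem ((\<lambda>x. S `` {F x}) ` C)"

definition pull_map ::
    "('d, 'n) monoid_scheme \<Rightarrow> ('d \<Rightarrow> 'g) \<Rightarrow> ('g \<Rightarrow> 'b) \<Rightarrow> 'd \<Rightarrow> 'b" where
  "pull_map \<Delta> f \<alpha> = (\<lambda>d \<in> carrier \<Delta>. \<alpha> (f d))"

definition pull_cocycle ::
    "('d, 'n) monoid_scheme \<Rightarrow> ('d \<Rightarrow> 'g) \<Rightarrow> ('g \<Rightarrow> 'k) \<times> ('g \<times> 'g \<Rightarrow> 'h)
      \<Rightarrow> ('d \<Rightarrow> 'k) \<times> ('d \<times> 'd \<Rightarrow> 'h)" where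
  "pull_cocycle \<Delta> f = (\<lambda>(\<alpha>, u). (pull_map \<Delta> f \<alpha>,
     (\<lambda>(d, e) \<in> carrier \<Delta> \<times> carrier \<Delta>. u (f d, f e))))"

definition kernel_of ::
    "('g, 'm) monoid_scheme \<Rightarrow> ('g \<Rightarrow> 'a::unital_cstar_algebra \<Rightarrow> 'a) \<times> ('g \<times> 'g \<Rightarrow> 'a set)
      \<Rightarrow> 'g \<Rightarrow> ('a \<Rightarrow> 'a) set" where
  "kernel_of \<Gamma> = (\<lambda>(\<alpha>, u). \<lambda>g \<in> carrier \<Gamma>. quot_Out (\<alpha> g))"


section \<open>The crossed modules of a C*-algebra satisfy the axioms\<close>

text \<open>The results of this section, culminating in \<open>crossed_module_PG\<close> and
  \<open>crossed_module_PG_tr\<close>, are not needed to state anything above.  They confirm that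
  \<^const>\<open>PG\<close> and \<^const>\<open>PG_tr\<close> are crossed modules of topological groups.\<close>

subsection \<open>Self-adjoint contractions as averages of unitaries\<close>

lemma star_one: "star 1 = (1::'a::unital_cstar_algebra)"
  by (metis star_star star_mult mult_1_left mult_1_right)

lemma star_zero: "star 0 = (0::'a::unital_cstar_algebra)"
  by (metis add_cancel_left_left star_add)

lemma star_minus: "star (- x) = - star (x::'a::unital_cstar_algebra)"
  by (metis add.right_inverse minus_unique star_add star_zero)

lemma star_diff: "star (x - y) = star x - star (y::'a::unital_cstar_algebra)"
  using star_add[of x "- y"] by (simp add: star_minus)

lemma star_scaleR: "star (scaleR r x) = scaleR r (star (x::'a::unital_cstar_algebra))"
  by (simp add: scaleR_eq_scaleC star_scaleC)

lemma scaleC_one: "scaleC 1 x = (x::'a::unital_cstar_algebra)"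
  using scaleR_eq_scaleC[of 1 x] by simp

lemma scaleC_minus_left: "scaleC (- c) x = - scaleC c (x::'a::unital_cstar_algebra)"
  using scaleR_eq_scaleC[of "-1" "scaleC c x"] by (simp add: scaleC_scaleC)

lemma scaleC_diff_right: "scaleC c (x - y) = scaleC c x - scaleC c (y::'a::unital_cstar_algebra)"
  using scaleC_add_right[of c "x - y" y] by simp

lemma norm_star_le: "norm x \<le> norm (star (x::'a::unital_cstar_algebra))"
proof (cases "norm x = 0")
  case False
  have "norm x * norm x \<le> norm (star x) * norm x"
    using norm_mult_ineq[of "star x" x] by (simp add: cstar_identity power2_eq_square)
  then show ?thesis using False by simp
qed simp

lemma norm_star: "norm (star x) = norm (x::'a::unital_cstar_algebra)"
  using norm_star_le[of x] norm_star_le[of "star x"] by (simp add: star_star)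

lemma bounded_linear_star: "bounded_linear (star :: 'a::unital_cstar_algebra \<Rightarrow> 'a)"
  by (rule bounded_linear_intro[where K = 1]) (auto simp: star_add star_scaleR norm_star)

lemma norm_unitary_le: "norm u \<le> 1" if "unitary u" for u :: "'a::unital_cstar_algebra"
proof -
  have one: "norm (1::'a) = (norm (1::'a))\<^sup>2"
    using cstar_identity[of "1::'a"] by (simp add: star_one)
  then have n1: "norm (1::'a) \<le> 1"
    by (smt (verit) power2_eq_square mult_cancel_left1)
  have "(norm u)\<^sup>2 \<le> 1"
    using cstar_identity[of u] that n1 by (simp add: unitary_def)
  then show ?thesis by (simp add: abs_square_le_1)
qed

lemma unitary_1: "unitary 1"
  by (simp add: unitary_def star_one)

lemma norm_pow_le: "norm (x ^ n) \<le> norm x ^ n" for x :: "'a::unital_cstar_algebra"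
proof (induction n)
  case 0
  show ?case using norm_unitary_le[OF unitary_1, where 'a = 'a] by simp
next
  case (Suc n)
  have "norm (x ^ Suc n) \<le> norm x * norm (x ^ n)" by (simp add: norm_mult_ineq)
  also have "\<dots> \<le> norm x * norm x ^ n" by (intro mult_left_mono Suc) simp
  finally show ?case by simp
qed

lemma sqrt_one_minus:
  fixes a :: "'a::unital_cstar_algebra"
  assumes "norm a < 1"
  obtains b where "b * b = 1 - a" "\<And>x. x * a = a * x \<Longrightarrow> x * b = b * x"
    "star a = a \<Longrightarrow> star b = b"
proof -
  define c :: "nat \<Rightarrow> real" where "c n = ((1/2) gchoose n) * (-1) ^ n" for n
  define f where "f n = scaleR (c n) (a ^ n)" for n
  obtain r where r: "norm a < r" "r < 1" using assms dense by blast
  then have r0: "0 < r" by (smt (verit) norm_ge_zero)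
  have "(\<lambda>n. ((1/2) gchoose n) * (-r) ^ n) sums (1 + (-r)) powr (1/2)"
    by (rule gen_binomial_real) (use r r0 in auto)
  moreover have "(\<lambda>n. ((1/2) gchoose n) * (-r) ^ n) = (\<lambda>n. c n * r ^ n)"
    by (rule ext) (metis (no_types, lifting) c_def mult.assoc power_minus)
  ultimately have "summable (\<lambda>n. c n * r ^ n)" by (simp add: sums_iff)
  then have "summable (\<lambda>n. norm (c n * norm a ^ n))"
    by (rule powser_insidea) (use r in auto)
  then have sumn: "summable (\<lambda>n. norm (f n))"
  proof (rule summable_comparison_test'[where N = 0])
    fix n show "norm (norm (f n)) \<le> norm (c n * norm a ^ n)"
      using norm_pow_le[of a n] by (simp add: f_def abs_mult mult_left_mono)
  qed
  then have sumf: "summable f" by (rule summable_norm_cancel)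
  have conv: "(\<Sum>i\<le>k. f i * f (k - i)) = scaleR ((1 gchoose k) * (-1) ^ k) (a ^ k)" for k
  proof -
    have "f i * f (k - i) = scaleR (c i * c (k - i)) (a ^ k)" if "i \<le> k" for i
      using that by (simp add: f_def flip: power_add)
    then have "(\<Sum>i\<le>k. f i * f (k - i)) = scaleR (\<Sum>i\<le>k. c i * c (k - i)) (a ^ k)"
      by (simp add: scaleR_sum_left)
    also have "(\<Sum>i\<le>k. c i * c (k - i))
      = (\<Sum>i\<le>k. ((1/2) gchoose i) * ((1/2) gchoose (k - i))) * (-1) ^ k"
      unfolding sum_distrib_right
    proof (rule sum.cong)
      fix i assume "i \<in> {..k}"
      then have "(-1::real) ^ i * (-1) ^ (k - i) = (-1) ^ k" by (simp flip: power_add)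
      then show "c i * c (k - i) = ((1/2) gchoose i) * ((1/2) gchoose (k - i)) * (-1) ^ k"
        by (simp add: c_def algebra_simps)
    qed simp
    also have "(\<Sum>i\<le>k. ((1/2::real) gchoose i) * ((1/2) gchoose (k - i))) = (1 gchoose k)"
      using gbinomial_Vandermonde[of "1/2::real" "1/2" k] by (simp add: atMost_atLeast0)
    finally show ?thesis .
  qed
  have tail: "(1::real) gchoose k = 0" if "k \<ge> 2" for k
    using that binomial_gbinomial[of 1 k, where 'a = real] by (simp add: binomial_eq_0)
  have "(\<lambda>k. \<Sum>i\<le>k. f i * f (k - i)) sums (suminf f * suminf f)"
    by (rule Cauchy_product_sums[OF sumn sumn])
  moreover have "(\<lambda>k. \<Sum>i\<le>k. f i * f (k - i)) sums (\<Sum>k\<in>{0,1}. \<Sum>i\<le>k. f i * f (k - i))"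
    by (rule sums_finite) (use tail in \<open>auto simp: conv\<close>)
  ultimately have "suminf f * suminf f = (\<Sum>k\<in>{0,1}. \<Sum>i\<le>k. f i * f (k - i))"
    by (rule sums_unique2)
  also have "\<dots> = 1 - a" by (simp add: conv)
  finally have sq: "suminf f * suminf f = 1 - a" .
  have comm: "x * suminf f = suminf f * x" if "x * a = a * x" for x
  proof -
    have "x * a ^ n = a ^ n * x" for n
      by (induction n) (simp, metis mult.assoc power_Suc that)
    then have "(\<lambda>n. x * f n) = (\<lambda>n. f n * x)" by (simp add: f_def)
    then show ?thesis
      using suminf_mult[OF sumf, of x] suminf_mult2[OF sumf, of x] by simp
  qed
  have sa: "star (suminf f) = suminf f" if "star a = a"
  proof -
    have "star (a ^ n) = a ^ n" for n
      by (induction n) (simp add: star_one, metis star_mult that power_Suc power_Suc2)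
    then have "(\<lambda>n. star (f n)) = f" by (simp add: f_def[abs_def] star_scaleR)
    then show ?thesis
      using bounded_linear.suminf[OF bounded_linear_star sumf] by simp
  qed
  show ?thesis by (rule that[OF sq comm sa])
qed

lemma sa_contraction:
  fixes a :: "'a::unital_cstar_algebra"
  assumes "norm a < 1" "star a = a"
  obtains u where "unitary u" "unitary (star u)" "a = scaleR (1/2) (u + star u)"
proof -
  have "norm (a * a) < 1"
    by (rule le_less_trans[OF norm_mult_ineq]) (use assms in \<open>simp add: mult_le_one mult_strict_mono
      abs_square_less_1 flip: power2_eq_square\<close>)
  then obtain b where b: "b * b = 1 - a * a" "\<And>x. x * (a * a) = (a * a) * x \<Longrightarrow> x * b = b * x"
    "star (a * a) = a * a \<Longrightarrow> star b = b" using sqrt_one_minus by blast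
  have ab: "a * b = b * a" by (rule b(2)) (simp add: mult.assoc)
  have sb: "star b = b" by (rule b(3)) (simp add: star_mult assms)
  define u where "u = a + scaleC \<i> b"
  have su: "star u = a - scaleC \<i> b"
    by (simp add: u_def star_add star_scaleC assms sb scaleC_minus_left)
  have "star u * u = 1" "u * star u = 1"
    unfolding su unfolding u_def
    by (simp_all add: algebra_simps mult_scaleC_left mult_scaleC_right scaleC_scaleC ab b(1)
      scaleC_minus_left scaleC_one scaleC_add_right scaleC_diff_right)
  then have "unitary u" "unitary (star u)" by (simp_all add: unitary_def star_star)
  moreover have "a = scaleR (1/2) (u + star u)"
  proof -
    have "u + star u = scaleR 2 a"
      unfolding su unfolding u_def by (simp add: scaleR_2)
    then show ?thesis by simp
  qed
  ultimately show ?thesis using that by blast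
qed


subsection \<open>Unitaries, automorphisms and the associated groups\<close>

lemma sa_decomposition:
  fixes a :: "'a::unital_cstar_algebra"
  obtains h k where "star h = h" "star k = k" "a = h + scaleC \<i> k"
proof -
  define h where "h = scaleC (1/2) (a + star a)"
  define k where "k = scaleC (-\<i>/2) (a - star a)"
  have "star h = h" by (simp add: h_def star_scaleC star_add star_star add.commute)
  moreover have "star k = k"
    by (simp add: k_def star_scaleC star_diff star_star scaleC_minus_left scaleC_diff_right)
  moreover have "h + scaleC \<i> k = a"
  proof -
    have "h + scaleC \<i> k = scaleC (1/2) (a + star a + (a - star a))"
      by (simp add: h_def k_def scaleC_scaleC flip: scaleC_add_right)
    also have "\<dots> = scaleC (1/2) (scaleC 2 a)"
      using scaleC_add_left[of 1 1 a] by (simp add: scaleC_one)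
    finally show ?thesis by (simp add: scaleC_scaleC scaleC_one)
  qed
  ultimately show ?thesis using that by metis
qed

lemma unitary_star: "unitary u \<Longrightarrow> unitary (star u)"
  by (simp add: unitary_def star_star)

lemma unitary_mult: "unitary u \<Longrightarrow> unitary v \<Longrightarrow> unitary (u * v)"
  unfolding unitary_def star_mult by (metis mult.assoc mult_1_left)

lemma commutes_with_all:
  fixes z :: "'a::unital_cstar_algebra"
  assumes "\<And>u. unitary u \<Longrightarrow> z * u = u * z"
  shows "z * a = a * z"
proof -
  have sa: "z * h = h * z" if h: "star h = h" for h
  proof -
    define s where "s = norm h + 1"
    have s: "s > 0" by (simp add: s_def add_nonneg_pos)
    define h' where "h' = scaleR (1/s) h"
    have "norm h' < 1" "star h' = h'"
      using s by (simp_all add: h'_def star_scaleR h) (simp add: s_def)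
    then obtain u where "unitary u" "unitary (star u)" and e: "h' = scaleR (1/2) (u + star u)"
      using sa_contraction by blast
    then have "z * h' = h' * z" using assms by (simp add: algebra_simps)
    moreover have "h = scaleR s h'" using s by (simp add: h'_def)
    ultimately show ?thesis by simp
  qed
  obtain h k where "star h = h" "star k = k" "a = h + scaleC \<i> k"
    by (rule sa_decomposition)
  then show ?thesis
    by (simp add: sa distrib_left distrib_right mult_scaleC_left mult_scaleC_right)
qed

lemma star_automorphismD:
  assumes "star_automorphism \<phi>"
  shows "bij \<phi>" "\<phi> (x + y) = \<phi> x + \<phi> y" "\<phi> (scaleC c x) = scaleC c (\<phi> x)"
    "\<phi> (x * y) = \<phi> x * \<phi> y" "\<phi> (star x) = star (\<phi> x)"
    "\<phi> (scaleR r x) = scaleR r (\<phi> x)" "\<phi> (x - y) = \<phi> x - \<phi> y" "\<phi> 1 = 1"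
proof -
  show a: "bij \<phi>" "\<phi> (x + y) = \<phi> x + \<phi> y" "\<phi> (scaleC c x) = scaleC c (\<phi> x)"
    "\<phi> (x * y) = \<phi> x * \<phi> y" "\<phi> (star x) = star (\<phi> x)" for x y c
    using assms by (auto simp: star_automorphism_def)
  show "\<phi> (scaleR r x) = scaleR r (\<phi> x)"
    by (simp add: scaleR_eq_scaleC a)
  show "\<phi> (x - y) = \<phi> x - \<phi> y" using a(2)[of "x - y" y] by simp
  obtain e where e: "\<phi> e = 1" using a(1) by (metis bij_pointE)
  show "\<phi> 1 = 1" using a(4)[of e 1] e by simp
qed

lemma star_automorphism_unitary: "star_automorphism \<phi> \<Longrightarrow> unitary u \<Longrightarrow> unitary (\<phi> u)"
  unfolding unitary_def by (metis star_automorphismD(4,5,8))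

lemma star_automorphism_inv: "star_automorphism \<phi> \<Longrightarrow> star_automorphism (inv_into UNIV \<phi>)"
proof -
  assume a: "star_automorphism \<phi>"
  note b = star_automorphismD[OF a]
  have i: "\<phi> (inv_into UNIV \<phi> x) = x" "inv_into UNIV \<phi> (\<phi> x) = x" for x
    using b(1) by (simp_all add: bij_is_surj surj_f_inv_f bij_is_inj)
  have *: "inv_into UNIV \<phi> y = x" if "\<phi> x = y" for x y
    using that i by auto
  show ?thesis unfolding star_automorphism_def
    by (intro conjI allI bij_imp_bij_inv b(1); rule *) (simp_all add: b(2-5) i)
qed

lemma star_automorphism_comp:
  "star_automorphism \<phi> \<Longrightarrow> star_automorphism \<psi> \<Longrightarrow> star_automorphism (\<phi> \<circ> \<psi>)"
  unfolding star_automorphism_def by (auto intro: bij_comp)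

lemma star_automorphism_id: "star_automorphism id"
  by (simp add: star_automorphism_def)

lemma star_automorphism_norm_le:
  fixes \<phi> :: "'a::unital_cstar_algebra \<Rightarrow> 'a"
  assumes "star_automorphism \<phi>"
  shows "norm (\<phi> x) \<le> norm x"
proof -
  note b = star_automorphismD[OF assms]
  have sa: "norm (\<phi> a) \<le> norm a" if "star a = a" for a
  proof (rule dense_ge)
    fix s assume s: "norm a < s"
    then have s0: "s > 0" by (smt (verit) norm_ge_zero)
    have "norm (scaleR (1/s) a) < 1" "star (scaleR (1/s) a) = scaleR (1/s) a"
      using s s0 that by (simp_all add: star_scaleR)
    then obtain u where u: "unitary u" "unitary (star u)"
      and e: "scaleR (1/s) a = scaleR (1/2) (u + star u)"
      using sa_contraction by blast
    have "norm (\<phi> u + \<phi> (star u)) \<le> 2"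
      using norm_unitary_le[OF star_automorphism_unitary[OF assms u(1)]]
        norm_unitary_le[OF star_automorphism_unitary[OF assms u(2)]]
        norm_triangle_ineq[of "\<phi> u" "\<phi> (star u)"] by linarith
    moreover have "scaleR (1/s) (\<phi> a) = scaleR (1/2) (\<phi> u + \<phi> (star u))"
      using arg_cong[OF e, of \<phi>] by (simp only: b)
    from arg_cong[OF this, of norm] have "norm (\<phi> a) / s = norm (\<phi> u + \<phi> (star u)) / 2"
      using s0 by simp
    ultimately have "norm (\<phi> a) / s \<le> 1" by linarith
    then show "norm (\<phi> a) \<le> s" using s0 by (simp add: divide_le_eq_1)
  qed
  have "(norm (\<phi> x))\<^sup>2 = norm (\<phi> (star x * x))" by (simp add: b cstar_identity)
  also have "\<dots> \<le> norm (star x * x)" by (rule sa) (simp add: star_mult star_star)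
  also have "\<dots> = (norm x)\<^sup>2" by (rule cstar_identity)
  finally show ?thesis by (rule power2_le_imp_le) simp
qed

lemma star_automorphism_norm:
  fixes \<phi> :: "'a::unital_cstar_algebra \<Rightarrow> 'a"
  assumes "star_automorphism \<phi>"
  shows "norm (\<phi> x) = norm x"
  using star_automorphism_norm_le[OF assms, of x]
    star_automorphism_norm_le[OF star_automorphism_inv[OF assms], of "\<phi> x"]
    star_automorphismD(1)[OF assms] by (simp add: bij_is_inj)

lemma U_grp_simps [simp]: "carrier U_grp = {u. unitary u}" "x \<otimes>\<^bsub>U_grp\<^esub> y = x * y" "\<one>\<^bsub>U_grp\<^esub> = 1"
  by (simp_all add: U_grp_def)

lemma group_U_grp: "group (U_grp :: 'a::unital_cstar_algebra monoid)"
proof (rule groupI)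
  fix x :: 'a assume "x \<in> carrier U_grp"
  then show "\<exists>y\<in>carrier U_grp. y \<otimes>\<^bsub>U_grp\<^esub> x = \<one>\<^bsub>U_grp\<^esub>"
    by (intro bexI[of _ "star x"]) (auto simp: unitary_def star_star)
qed (auto simp: unitary_mult unitary_1 mult.assoc)

lemma inv_U_grp: "unitary u \<Longrightarrow> inv\<^bsub>U_grp\<^esub> u = star u"
  by (rule group.inv_equality[OF group_U_grp]) (auto simp: unitary_def star_star)

lemma ZU_iff: "z \<in> ZU \<longleftrightarrow> unitary z \<and> (\<forall>a. z * a = a * z)"
  using commutes_with_all[of z] by (auto simp: ZU_def)

lemma ZU_I: "unitary z \<Longrightarrow> (\<And>a. z * a = a * z) \<Longrightarrow> z \<in> ZU"
  by (simp add: ZU_def)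

lemma ZU_unitary: "z \<in> ZU \<Longrightarrow> unitary z"
  by (simp add: ZU_def)

lemma ZU_comm: "z \<in> ZU \<Longrightarrow> z * a = a * z"
  using ZU_iff by blast

lemma one_in_ZU: "1 \<in> ZU"
  by (rule ZU_I) (simp_all add: unitary_1)

lemma normal_ZU: "ZU \<lhd> (U_grp :: 'a::unital_cstar_algebra monoid)"
proof -
  interpret group "U_grp :: 'a monoid" by (rule group_U_grp)
  have "subgroup (ZU :: 'a set) U_grp"
  proof (rule subgroupI)
    show "(ZU :: 'a set) \<noteq> {}" using one_in_ZU by blast
    fix a :: 'a assume a: "a \<in> ZU"
    have "star a * x = x * star a" for x
      using arg_cong[OF ZU_comm[OF a, of "star x"], of star] by (simp add: star_mult star_star)
    then show "inv\<^bsub>U_grp\<^esub> a \<in> ZU"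
      unfolding inv_U_grp[OF ZU_unitary[OF a]]
      by (rule ZU_I[OF unitary_star[OF ZU_unitary[OF a]]])
  next
    fix a b :: 'a assume a: "a \<in> ZU" and b: "b \<in> ZU"
    have "a * b * x = x * (a * b)" for x
      using ZU_comm[OF a] ZU_comm[OF b] by (metis mult.assoc)
    then show "a \<otimes>\<^bsub>U_grp\<^esub> b \<in> ZU"
      unfolding U_grp_simps by (rule ZU_I[OF unitary_mult[OF ZU_unitary[OF a] ZU_unitary[OF b]]])
  qed (auto simp: ZU_unitary)
  then show ?thesis
    unfolding normal_inv_iff
  proof (intro conjI ballI)
    fix x h assume "x \<in> carrier (U_grp :: 'a monoid)" and h: "h \<in> (ZU :: 'a set)"
    then have x: "unitary x" by simp
    have "x * h * star x = h * (x * star x)"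
      using ZU_comm[OF h] by (metis mult.assoc)
    then show "x \<otimes>\<^bsub>U_grp\<^esub> h \<otimes>\<^bsub>U_grp\<^esub> inv\<^bsub>U_grp\<^esub> x \<in> ZU"
      using x h by (simp add: inv_U_grp) (simp add: unitary_def)
  qed
qed

lemma group_PU: "group PU"
  unfolding PU_def by (rule normal.factorgroup_is_group[OF normal_ZU])

lemma Aut_simps [simp]: "carrier Aut = {\<phi>. star_automorphism \<phi>}" "x \<otimes>\<^bsub>Aut\<^esub> y = x \<circ> y" "\<one>\<^bsub>Aut\<^esub> = id"
  by (simp_all add: Aut_def)

lemma group_Aut: "group (Aut :: ('a::unital_cstar_algebra \<Rightarrow> 'a) monoid)"
proof (rule groupI)
  fix x :: "'a \<Rightarrow> 'a" assume "x \<in> carrier Aut"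
  then show "\<exists>y\<in>carrier Aut. y \<otimes>\<^bsub>Aut\<^esub> x = \<one>\<^bsub>Aut\<^esub>"
    by (intro bexI[of _ "inv_into UNIV x"])
      (auto simp: star_automorphism_inv dest!: star_automorphismD(1) bij_is_inj)
qed (auto simp: star_automorphism_comp star_automorphism_id comp_assoc)

lemma inv_Aut: "star_automorphism \<phi> \<Longrightarrow> inv\<^bsub>Aut\<^esub> \<phi> = inv_into UNIV \<phi>"
  by (rule group.inv_equality[OF group_Aut])
    (auto simp: star_automorphism_inv dest!: star_automorphismD(1) bij_is_inj)

lemma star_automorphism_Ad: "unitary u \<Longrightarrow> star_automorphism (Ad u)"
proof -
  assume u: "unitary u"
  then have c: "star u * (u * x) = x" "u * (star u * x) = x" for x
    by (auto simp: unitary_def simp flip: mult.assoc)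
  have "bij (Ad u)"
    by (rule bij_betw_byWitness[where f' = "Ad (star u)"])
      (use u in \<open>auto simp: Ad_def mult.assoc c star_star unitary_def\<close>)
  then show ?thesis
    by (auto simp: star_automorphism_def Ad_def distrib_left distrib_right mult_scaleC_left
        mult_scaleC_right star_mult star_star mult.assoc c)
qed

lemma Ad_mult: "Ad (u * v) = Ad u \<circ> Ad v"
  by (auto simp: Ad_def star_mult mult.assoc)

lemma Ad_one: "Ad 1 = id"
  by (auto simp: Ad_def star_one)

lemma Ad_inv: "unitary u \<Longrightarrow> inv\<^bsub>Aut\<^esub> (Ad u) = Ad (star u)"
  by (rule group.inv_equality[OF group_Aut])
    (auto simp: star_automorphism_Ad unitary_star simp flip: Ad_mult,
     auto simp: unitary_def Ad_one)

lemma Ad_conj: "star_automorphism \<phi> \<Longrightarrow> \<phi> \<circ> Ad u \<circ> inv\<^bsub>Aut\<^esub> \<phi> = Ad (\<phi> u)"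
  by (auto simp: inv_Aut Ad_def star_automorphismD bij_is_surj surj_f_inv_f)

lemma normal_Inn: "Inn \<lhd> (Aut :: ('a::unital_cstar_algebra \<Rightarrow> 'a) monoid)"
proof -
  interpret group "Aut :: ('a \<Rightarrow> 'a) monoid" by (rule group_Aut)
  have "subgroup (Inn :: ('a \<Rightarrow> 'a) set) Aut"
  proof (rule subgroupI)
    show "(Inn :: ('a \<Rightarrow> 'a) set) \<noteq> {}" using unitary_1 by (auto simp: Inn_def)
    fix a b :: "'a \<Rightarrow> 'a" assume "a \<in> Inn" "b \<in> Inn"
    then show "a \<otimes>\<^bsub>Aut\<^esub> b \<in> Inn"
      by (auto simp: Inn_def unitary_mult intro!: imageI simp flip: Ad_mult)
  qed (auto simp: Inn_def star_automorphism_Ad Ad_inv unitary_star intro!: imageI)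
  then show ?thesis
    unfolding normal_inv_iff
    by (auto simp: Inn_def Ad_conj star_automorphism_unitary intro!: imageI)
qed

lemma group_Out: "group Out"
  unfolding Out_def by (rule normal.factorgroup_is_group[OF normal_Inn])


subsection \<open>Topology\<close>

lemma continuous_on_eval:
  "continuous_on ({\<phi>. star_automorphism \<phi>} \<times> UNIV) (\<lambda>(\<phi>, x). \<phi> x :: 'a::unital_cstar_algebra)"
  unfolding continuous_on_def
proof
  fix p :: "('a \<Rightarrow> 'a) \<times> 'a" assume p: "p \<in> {\<phi>. star_automorphism \<phi>} \<times> UNIV"
  obtain \<phi>0 x0 where p0: "p = (\<phi>0, x0)" by (cases p)
  let ?F = "at p within {\<phi>. star_automorphism \<phi>} \<times> (UNIV :: 'a set)"
  have c1: "((\<lambda>q. fst q x0) \<longlongrightarrow> \<phi>0 x0) ?F"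
  proof -
    have "continuous_on UNIV (\<lambda>q :: ('a \<Rightarrow> 'a) \<times> 'a. fst q x0)"
      by (rule continuous_on_compose2[OF continuous_on_product_coordinates[of x0]])
        (auto intro: continuous_on_fst continuous_on_id)
    then have "((\<lambda>q :: ('a \<Rightarrow> 'a) \<times> 'a. fst q x0) \<longlongrightarrow> fst p x0) (at p)"
      unfolding continuous_on_def by blast
    then show ?thesis unfolding p0 fst_conv by (rule tendsto_within_subset) simp
  qed
  have c2: "(snd \<longlongrightarrow> x0) ?F"
    using tendsto_snd[OF tendsto_ident_at[of p]] by (simp add: p0)
  have "((\<lambda>q. norm (snd q - x0) + norm (fst q x0 - \<phi>0 x0)) \<longlongrightarrow> norm (x0 - x0) + norm (\<phi>0 x0 - \<phi>0 x0)) ?F"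
    by (intro tendsto_intros c1 c2)
  then have lim: "((\<lambda>q. norm (snd q - x0) + norm (fst q x0 - \<phi>0 x0)) \<longlongrightarrow> 0) ?F" by simp
  have "((\<lambda>q. (case q of (\<phi>, x) \<Rightarrow> \<phi> x) - \<phi>0 x0) \<longlongrightarrow> 0) ?F"
  proof (rule Lim_null_comparison[OF _ lim])
    show "\<forall>\<^sub>F q in ?F. norm ((case q of (\<phi>, x) \<Rightarrow> \<phi> x) - \<phi>0 x0)
        \<le> norm (snd q - x0) + norm (fst q x0 - \<phi>0 x0)"
      unfolding eventually_at_filter
    proof (rule always_eventually, intro allI impI)
      fix q :: "('a \<Rightarrow> 'a) \<times> 'a" assume "q \<in> {\<phi>. star_automorphism \<phi>} \<times> UNIV"
      then obtain \<phi> x where q: "q = (\<phi>, x)" "star_automorphism \<phi>" by auto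
      have "\<phi> x - \<phi>0 x0 = \<phi> (x - x0) + (\<phi> x0 - \<phi>0 x0)" by (simp add: star_automorphismD(7)[OF q(2)])
      then show "norm ((case q of (\<phi>, x) \<Rightarrow> \<phi> x) - \<phi>0 x0) \<le> norm (snd q - x0) + norm (fst q x0 - \<phi>0 x0)"
        by (metis q star_automorphism_norm norm_triangle_ineq fst_conv snd_conv case_prod_conv)
    qed
  qed
  then show "((\<lambda>(\<phi>, x). \<phi> x) \<longlongrightarrow> (case p of (\<phi>, x) \<Rightarrow> \<phi> x)) ?F"
    by (subst Lim_null) (simp add: p0)
qed

lemma continuous_on_aut_inv:
  "continuous_on {\<phi>. star_automorphism \<phi>} (\<lambda>\<phi>. inv_into UNIV \<phi> :: 'a::unital_cstar_algebra \<Rightarrow> 'a)"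
proof (rule continuous_on_coordinatewise_then_product)
  fix a :: 'a
  show "continuous_on {\<phi>. star_automorphism \<phi>} (\<lambda>\<phi> :: 'a \<Rightarrow> 'a. inv_into UNIV \<phi> a)"
    unfolding continuous_on_def
  proof
    fix \<phi>0 :: "'a \<Rightarrow> 'a" assume p0: "\<phi>0 \<in> {\<phi>. star_automorphism \<phi>}"
    let ?F = "at \<phi>0 within {\<phi> :: 'a \<Rightarrow> 'a. star_automorphism \<phi>}"
    let ?b = "inv_into UNIV \<phi>0 a"
    have b: "\<phi>0 ?b = a" using p0 by (auto dest!: star_automorphismD(1) simp: bij_is_surj surj_f_inv_f)
    have "((\<lambda>\<phi> :: 'a \<Rightarrow> 'a. \<phi> ?b) \<longlongrightarrow> \<phi>0 ?b) (at \<phi>0)"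
      using continuous_on_product_coordinates[of ?b, where 'b = 'a] unfolding continuous_on_def by blast
    then have "((\<lambda>\<phi> :: 'a \<Rightarrow> 'a. \<phi> ?b) \<longlongrightarrow> \<phi>0 ?b) ?F"
      by (rule tendsto_within_subset) simp
    then have "((\<lambda>\<phi>. norm (\<phi>0 ?b - \<phi> ?b)) \<longlongrightarrow> norm (\<phi>0 ?b - \<phi>0 ?b)) ?F"
      by (intro tendsto_intros)
    then have lim: "((\<lambda>\<phi>. norm (\<phi>0 ?b - \<phi> ?b)) \<longlongrightarrow> 0) ?F" by simp
    have "((\<lambda>\<phi>. inv_into UNIV \<phi> a - ?b) \<longlongrightarrow> 0) ?F"
    proof (rule Lim_null_comparison[OF _ lim])
      show "\<forall>\<^sub>F \<phi> in ?F. norm (inv_into UNIV \<phi> a - ?b) \<le> norm (\<phi>0 ?b - \<phi> ?b)"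
        unfolding eventually_at_filter
      proof (rule always_eventually, intro allI impI)
        fix \<phi> :: "'a \<Rightarrow> 'a" assume "\<phi> \<in> {\<phi>. star_automorphism \<phi>}"
        then have f: "star_automorphism \<phi>" by simp
        have "\<phi> (inv_into UNIV \<phi> a - ?b) = \<phi>0 ?b - \<phi> ?b"
          using star_automorphismD(1,7)[OF f] b by (simp add: bij_is_surj surj_f_inv_f)
        then show "norm (inv_into UNIV \<phi> a - ?b) \<le> norm (\<phi>0 ?b - \<phi> ?b)"
          by (metis f star_automorphism_norm order_refl)
      qed
    qed
    then show "((\<lambda>\<phi>. inv_into UNIV \<phi> a) \<longlongrightarrow> ?b) ?F" by (subst Lim_null)
  qed
qed

lemma ptnorm_top_eq: "ptnorm_top S = top_of_set S"
  by (simp add: ptnorm_top_def euclidean_product_topology)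

lemma topological_group_Aut:
  fixes S :: "('a::unital_cstar_algebra \<Rightarrow> 'a) set"
  assumes S: "subgroup S Aut"
  shows "topological_group (Aut\<lparr>carrier := S\<rparr>) (ptnorm_top S)"
  unfolding topological_group_def ptnorm_top_eq
proof (intro conjI)
  interpret subgroup S Aut by (rule S)
  show grp: "group (Aut\<lparr>carrier := S\<rparr>)" by (rule subgroup_is_group[OF group_Aut])
  have sub: "S \<subseteq> {\<phi>. star_automorphism \<phi>}" using subset by simp
  have "continuous_on (S \<times> S) (\<lambda>(x, y). x \<circ> y :: 'a \<Rightarrow> 'a)"
  proof (rule continuous_on_coordinatewise_then_product)
    fix a :: 'a
    have "continuous_on (S \<times> S) (\<lambda>q. (\<lambda>(\<phi>, x). \<phi> x) (fst q, snd q a))"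
    proof (rule continuous_on_compose2[OF continuous_on_eval])
      have "continuous_on (S \<times> S) (\<lambda>q. snd q a)"
        by (rule continuous_on_compose2[OF continuous_on_product_coordinates[of a]])
          (auto intro: continuous_on_snd continuous_on_id)
      then show "continuous_on (S \<times> S) (\<lambda>q. (fst q, snd q a))"
        by (intro continuous_on_Pair continuous_on_fst continuous_on_id)
      show "(\<lambda>q. (fst q, snd q a)) ` (S \<times> S) \<subseteq> {\<phi>. star_automorphism \<phi>} \<times> UNIV"
      proof (rule image_subsetI)
        fix q assume "q \<in> S \<times> S"
        then have "fst q \<in> S" by (rule mem_Times_iff[THEN iffD1, THEN conjunct1])
        with sub show "(fst q, snd q a) \<in> {\<phi>. star_automorphism \<phi>} \<times> UNIV" by fast
      qed
    qed
    then show "continuous_on (S \<times> S) (\<lambda>q. (case q of (x, y) \<Rightarrow> x \<circ> y) a)"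
      by (simp add: case_prod_unfold)
  qed
  moreover have "(\<lambda>(x, y). x \<circ> y) \<in> S \<times> S \<rightarrow> S"
    using m_closed unfolding Aut_simps by fast
  ultimately show "continuous_map (prod_topology (top_of_set S) (top_of_set S)) (top_of_set S)
      (\<lambda>(x, y). x \<otimes>\<^bsub>Aut\<lparr>carrier := S\<rparr>\<^esub> y)"
    by simp
  have i: "inv\<^bsub>Aut\<lparr>carrier := S\<rparr>\<^esub> x = inv_into UNIV x" "inv_into UNIV x \<in> S" if "x \<in> S" for x
  proof -
    have e: "inv\<^bsub>Aut\<^esub> x = inv_into UNIV x" using that sub by (intro inv_Aut) blast
    then show "inv\<^bsub>Aut\<lparr>carrier := S\<rparr>\<^esub> x = inv_into UNIV x"
      using group.m_inv_consistent[OF group_Aut S that] by simp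
    show "inv_into UNIV x \<in> S"
      using subgroup.m_inv_closed[OF S that] unfolding e .
  qed
  have "continuous_on S (\<lambda>x. inv\<^bsub>Aut\<lparr>carrier := S\<rparr>\<^esub> x)"
    using continuous_on_subset[OF continuous_on_aut_inv sub] i(1) by (simp cong: continuous_on_cong)
  then show "continuous_map (top_of_set S) (top_of_set S) (\<lambda>x. inv\<^bsub>Aut\<lparr>carrier := S\<rparr>\<^esub> x)"
    using i by auto
qed simp

abbreviation "pu u \<equiv> ZU #>\<^bsub>U_grp\<^esub> u"

lemma pu_eq: "pu u = (\<lambda>z. z * u) ` ZU"
  by (auto simp: r_coset_def)

lemma carrier_PU: "carrier PU = pu ` {u. unitary u}"
  by (simp add: PU_def carrier_FactGroup)

lemma PU_mult: "unitary u \<Longrightarrow> unitary v \<Longrightarrow> pu u \<otimes>\<^bsub>PU\<^esub> pu v = pu (u * v)"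
  using normal.rcos_sum[OF normal_ZU, of u v] by (simp add: PU_def)

lemma PU_one: "\<one>\<^bsub>PU\<^esub> = pu 1"
  by (simp add: PU_def FactGroup_def pu_eq)

lemma PU_inv: "unitary u \<Longrightarrow> inv\<^bsub>PU\<^esub> (pu u) = pu (star u)"
proof -
  assume u: "unitary u"
  then have "pu (star u) \<otimes>\<^bsub>PU\<^esub> pu u = \<one>\<^bsub>PU\<^esub>"
    by (simp add: PU_mult unitary_star PU_one) (simp add: unitary_def)
  then show ?thesis
    by (rule group.inv_equality[OF group_PU]) (use u in \<open>auto simp: carrier_PU unitary_star\<close>)
qed

lemma Ad_pu: "unitary u \<Longrightarrow> the_elem (Ad ` pu u) = Ad u"
proof -
  assume u: "unitary u"
  have "Ad (z * u) = Ad u" if "z \<in> ZU" for z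
  proof
    fix a
    have "z * u * a * star (z * u) = z * (u * a * star u) * star z"
      by (simp add: star_mult mult.assoc)
    also have "\<dots> = u * a * star u * (z * star z)"
      by (subst ZU_comm[OF that, of "u * a * star u"]) (simp add: mult.assoc)
    finally show "Ad (z * u) a = Ad u a"
      using ZU_unitary[OF that] by (simp add: Ad_def unitary_def)
  qed
  then have "Ad ` pu u = {Ad u}" using one_in_ZU by (auto simp: pu_eq image_image)
  then show ?thesis by simp
qed

lemma aut_ZU: "star_automorphism \<phi> \<Longrightarrow> \<phi> ` ZU \<subseteq> ZU"
proof
  fix y assume f: "star_automorphism \<phi>" and "y \<in> \<phi> ` ZU"
  then obtain z where z: "y = \<phi> z" "z \<in> ZU" by auto
  have "\<phi> z * a = a * \<phi> z" for a
  proof -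
    obtain b where "a = \<phi> b" using star_automorphismD(1)[OF f] by (metis bij_pointE)
    then show ?thesis using ZU_comm[OF z(2), of b] star_automorphismD(4)[OF f] by metis
  qed
  then show "y \<in> ZU" unfolding z(1)
    by (rule ZU_I[OF star_automorphism_unitary[OF f ZU_unitary[OF z(2)]]])
qed

lemma aut_pu:
  fixes \<phi> :: "'a::unital_cstar_algebra \<Rightarrow> 'a"
  assumes f: "star_automorphism \<phi>"
  shows "\<phi> ` pu u = pu (\<phi> u)"
proof -
  have "ZU \<subseteq> \<phi> ` ZU"
  proof
    fix z :: 'a assume z: "z \<in> ZU"
    have "inv_into UNIV \<phi> z \<in> ZU" using aut_ZU[OF star_automorphism_inv[OF f]] z by auto
    then show "z \<in> \<phi> ` ZU"
      using star_automorphismD(1)[OF f] by (intro image_eqI[of _ _ "inv_into UNIV \<phi> z"])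
        (simp_all add: bij_is_surj surj_f_inv_f)
  qed
  with aut_ZU[OF f] have "\<phi> ` ZU = ZU" by blast
  then have "(\<lambda>z. z * \<phi> u) ` ZU = (\<lambda>z. z * \<phi> u) ` \<phi> ` ZU" by simp
  then show ?thesis by (simp add: pu_eq image_image star_automorphismD(4)[OF f])
qed

lemma openin_PU_top:
  "openin PU_top W \<longleftrightarrow> W \<subseteq> carrier PU \<and> openin (top_of_set {u. unitary u}) {u. unitary u \<and> pu u \<in> W}"
proof -
  have eq: "{u. unitary u \<and> pu u \<in> V \<inter> W} = {u. unitary u \<and> pu u \<in> V} \<inter> {u. unitary u \<and> pu u \<in> W}"
    for V W :: "'a set set" by auto
  have eq2: "{u. unitary u \<and> pu u \<in> \<Union>K} = (\<Union>W\<in>K. {u. unitary u \<and> pu u \<in> W})"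
    for K :: "'a set set set" by auto
  have "istopology (\<lambda>W :: 'a set set. W \<subseteq> carrier PU
      \<and> openin (top_of_set {u. unitary u}) {u. unitary u \<and> pu u \<in> W})"
    unfolding istopology_def eq eq2 by (auto intro!: openin_Int openin_Union)
  then show ?thesis by (simp add: PU_top_def)
qed

lemma topspace_PU_top: "topspace PU_top = carrier PU"
proof -
  have "openin PU_top (carrier PU)"
    by (simp add: openin_PU_top carrier_PU) (metis (mono_tags, lifting) Collect_cong imageI mem_Collect_eq
      openin_subtopology_self)
  then show ?thesis
    by (metis openin_PU_top openin_subset openin_topspace subset_antisym)
qed

lemma continuous_pu: "continuous_map (top_of_set {u. unitary u}) PU_top pu"
  unfolding continuous_map_def topspace_PU_top openin_PU_top by (auto simp: carrier_PU)

lemma pu_cong: "z \<in> ZU \<Longrightarrow> unitary u \<Longrightarrow> pu (z * u) = pu u"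
proof -
  assume z: "z \<in> ZU" and u: "unitary u"
  note sg = normal_imp_subgroup[OF normal_ZU]
  have "ZU #>\<^bsub>U_grp\<^esub> z = ZU"
    by (rule group.coset_join2[OF group_U_grp _ sg z]) (simp add: ZU_unitary[OF z])
  then show ?thesis
    using group.coset_mult_assoc[OF group_U_grp subgroup.subset[OF sg], of z u] ZU_unitary[OF z] u
    by simp
qed

lemma open_pu: "open_map (top_of_set {u. unitary u}) PU_top pu"
  unfolding open_map_def
proof (intro allI impI)
  fix W :: "'a set" assume W: "openin (top_of_set {u. unitary u}) W"
  then have Wu: "W \<subseteq> {u. unitary u}" using openin_subset by fastforce
  have "{u. unitary u \<and> pu u \<in> pu ` W} = (\<Union>z\<in>ZU. {u \<in> {u. unitary u}. z * u \<in> W})"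
  proof (intro equalityI subsetI)
    fix u assume "u \<in> {u. unitary u \<and> pu u \<in> pu ` W}"
    then obtain w where u: "unitary u" and w: "w \<in> W" "pu u = pu w" by auto
    have "w \<in> pu w" unfolding pu_eq by (rule image_eqI[OF _ one_in_ZU]) simp
    then have "w \<in> pu u" by (simp only: w(2))
    then obtain z where "z \<in> ZU" "w = z * u" by (auto simp: pu_eq)
    with u w show "u \<in> (\<Union>z\<in>ZU. {u \<in> {u. unitary u}. z * u \<in> W})" by auto
  next
    fix u assume "u \<in> (\<Union>z\<in>ZU. {u \<in> {u. unitary u}. z * u \<in> W})"
    then obtain z where z: "z \<in> ZU" "unitary u" "z * u \<in> W" by auto
    then show "u \<in> {u. unitary u \<and> pu u \<in> pu ` W}" using pu_cong[of z u] by (metis imageI mem_Collect_eq)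
  qed
  moreover have "openin (top_of_set {u. unitary u}) {u \<in> {u. unitary u}. z * u \<in> W}" if "z \<in> ZU" for z
  proof -
    have "continuous_map (top_of_set {u. unitary u}) (top_of_set {u. unitary u}) (\<lambda>u. z * u)"
      using ZU_unitary[OF that] by (auto simp: unitary_mult intro!: continuous_intros)
    then show ?thesis using W by (auto simp: continuous_map_def)
  qed
  ultimately have "openin (top_of_set {u. unitary u}) {u. unitary u \<and> pu u \<in> pu ` W}" by auto
  then show "openin PU_top (pu ` W)" using Wu by (auto simp: openin_PU_top carrier_PU)
qed

lemma open_map_prod:
  assumes f: "open_map X X' f" and g: "open_map Y Y' g"
  shows "open_map (prod_topology X Y) (prod_topology X' Y') (\<lambda>(x, y). (f x, g y))"
  unfolding open_map_def
proof (intro allI impI)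
  fix W assume W: "openin (prod_topology X Y) W"
  show "openin (prod_topology X' Y') ((\<lambda>(x, y). (f x, g y)) ` W)"
    unfolding openin_prod_topology_alt
  proof (intro allI impI)
    fix a b assume "(a, b) \<in> (\<lambda>(x, y). (f x, g y)) ` W"
    then obtain x y where xy: "(x, y) \<in> W" "a = f x" "b = g y" by auto
    then obtain U V where UV: "openin X U" "openin Y V" "x \<in> U" "y \<in> V" "U \<times> V \<subseteq> W"
      using W[unfolded openin_prod_topology_alt, rule_format, OF xy(1)] by metis
    have "openin X' (f ` U)" "openin Y' (g ` V)"
      using f g UV(1,2) unfolding open_map_def by metis+
    moreover have "f ` U \<times> g ` V \<subseteq> (\<lambda>(x, y). (f x, g y)) ` W"
    proof
      fix q assume "q \<in> f ` U \<times> g ` V"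
      then obtain x1 y1 where q: "x1 \<in> U" "y1 \<in> V" "q = (f x1, g y1)" by fast
      with UV(5) have "(x1, y1) \<in> W" by fast
      then show "q \<in> (\<lambda>(x, y). (f x, g y)) ` W" by (rule rev_image_eqI) (simp add: q)
    qed
    ultimately show "\<exists>U V. openin X' U \<and> openin Y' V \<and> a \<in> U \<and> b \<in> V
        \<and> U \<times> V \<subseteq> (\<lambda>(x, y). (f x, g y)) ` W"
      using xy(2,3) UV(3,4) by (metis imageI)
  qed
qed

lemma quotient_pu: "quotient_map (top_of_set {u. unitary u}) PU_top pu"
  by (rule continuous_open_imp_quotient_map[OF continuous_pu open_pu])
    (simp add: topspace_PU_top carrier_PU)

lemma quotient_pu2:
  "quotient_map (top_of_set ({u. unitary u} \<times> {u. unitary u})) (prod_topology PU_top PU_top)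
     (\<lambda>(u, v). (pu u, pu v :: 'a::unital_cstar_algebra set))"
proof -
  have "continuous_map (prod_topology (top_of_set {u. unitary u}) (top_of_set {u. unitary u}))
      (prod_topology PU_top PU_top) (\<lambda>(u, v). (pu u, pu v :: 'a set))"
    unfolding case_prod_unfold
    by (intro continuous_map_pairedI continuous_map_compose[OF continuous_map_fst continuous_pu, unfolded comp_def]
        continuous_map_compose[OF continuous_map_snd continuous_pu, unfolded comp_def])
  then have "quotient_map (prod_topology (top_of_set {u. unitary u}) (top_of_set {u. unitary u}))
      (prod_topology PU_top PU_top) (\<lambda>(u, v). (pu u, pu v :: 'a set))"
    by (rule continuous_open_imp_quotient_map[OF _ open_map_prod[OF open_pu open_pu]])
      (force simp: topspace_PU_top carrier_PU)
  then show ?thesis unfolding prod_topology_subtopology_eu .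
qed

lemma quotient_id_pu:
  "quotient_map (top_of_set (S \<times> {u. unitary u})) (prod_topology (top_of_set S) PU_top)
     (\<lambda>(a, u). (a, pu u :: 'a::unital_cstar_algebra set))"
proof -
  have "continuous_map (prod_topology (top_of_set S) (top_of_set {u. unitary u}))
      (prod_topology (top_of_set S) PU_top) (\<lambda>(a, u). (a, pu u :: 'a set))"
    unfolding case_prod_unfold
    by (intro continuous_map_pairedI continuous_map_fst
        continuous_map_compose[OF continuous_map_snd continuous_pu, unfolded comp_def])
  then have "quotient_map (prod_topology (top_of_set S) (top_of_set {u. unitary u}))
      (prod_topology (top_of_set S) PU_top) (\<lambda>(a, u). (a, pu u :: 'a set))"
    by (rule continuous_open_imp_quotient_map[OF _ open_map_prod[OF _ open_pu]])
      (auto simp: open_map_def topspace_PU_top carrier_PU image_iff)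
  then show ?thesis unfolding prod_topology_subtopology_eu .
qed

lemma topological_group_PU: "topological_group (PU :: 'a::unital_cstar_algebra set monoid) PU_top"
  unfolding topological_group_def
proof (intro conjI group_PU topspace_PU_top)
  let ?U = "{u :: 'a. unitary u}"
  have "continuous_map (top_of_set (?U \<times> ?U)) (top_of_set ?U) (\<lambda>(u, v). u * v)"
    by (auto simp: unitary_mult case_prod_unfold intro!: continuous_intros)
  from continuous_map_compose[OF this continuous_pu]
  have "continuous_map (top_of_set (?U \<times> ?U)) PU_top (pu \<circ> (\<lambda>(u, v). u * v))" .
  then have "continuous_map (top_of_set (?U \<times> ?U)) PU_top
      ((\<lambda>(x, y). x \<otimes>\<^bsub>PU\<^esub> y) \<circ> (\<lambda>(u, v). (pu u, pu v)))"
    by (rule continuous_map_eq) (auto simp: PU_mult)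
  then show "continuous_map (prod_topology PU_top PU_top) PU_top (\<lambda>(x, y). x \<otimes>\<^bsub>PU\<^esub> (y :: 'a set))"
    by (rule continuous_compose_quotient_map[OF quotient_pu2])
  have "continuous_map (top_of_set ?U) (top_of_set ?U) star"
    by (auto simp: unitary_star intro!: linear_continuous_on bounded_linear_star)
  from continuous_map_compose[OF this continuous_pu]
  have "continuous_map (top_of_set ?U) PU_top (pu \<circ> star)" .
  then have "continuous_map (top_of_set ?U) PU_top ((\<lambda>x. inv\<^bsub>PU\<^esub> x) \<circ> pu)"
    by (rule continuous_map_eq) (auto simp: PU_inv)
  then show "continuous_map PU_top PU_top (\<lambda>x. inv\<^bsub>PU\<^esub> (x :: 'a set))"
    by (rule continuous_compose_quotient_map[OF quotient_pu])
qed

lemma crossed_module_PG_restrict: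
  fixes S :: "('a::unital_cstar_algebra \<Rightarrow> 'a) set"
  assumes S: "subgroup S Aut" and I: "Inn \<subseteq> S"
  shows "crossed_module (PG\<lparr>cod_grp := Aut\<lparr>carrier := S\<rparr>, cod_top := ptnorm_top S\<rparr>)"
proof -
  let ?U = "{u :: 'a. unitary u}"
  let ?b = "\<lambda>c :: 'a set. the_elem (Ad ` c)"
  interpret subgroup S Aut by (rule S)
  have sub: "S \<subseteq> {\<phi>. star_automorphism \<phi>}" using subset by simp
  then have aut: "star_automorphism \<phi>" if "\<phi> \<in> S" for \<phi> using that by auto
  have AdS: "Ad u \<in> S" if "unitary u" for u using I that by (auto simp: Inn_def)
  have hom: "?b \<in> hom PU (Aut\<lparr>carrier := S\<rparr>)"
    by (auto simp: hom_def carrier_PU Ad_pu AdS PU_mult unitary_mult Ad_mult)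
  have cb: "continuous_map PU_top (ptnorm_top S) ?b"
  proof (rule continuous_compose_quotient_map[OF quotient_pu])
    have "continuous_on ?U Ad"
      by (rule continuous_on_coordinatewise_then_product)
        (simp add: Ad_def, intro continuous_intros linear_continuous_on[OF bounded_linear_star])
    then have "continuous_map (top_of_set ?U) (ptnorm_top S) Ad"
      by (auto simp: ptnorm_top_eq AdS)
    then show "continuous_map (top_of_set ?U) (ptnorm_top S) (?b \<circ> pu)"
      by (rule continuous_map_eq) (auto simp: Ad_pu)
  qed
  have ca: "continuous_map (prod_topology (ptnorm_top S) PU_top) PU_top (\<lambda>(a, c). a ` c)"
    unfolding ptnorm_top_eq
  proof (rule continuous_compose_quotient_map[OF quotient_id_pu])
    have "continuous_on (S \<times> ?U) (\<lambda>(\<phi>, x). \<phi> x)"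
      by (rule continuous_on_subset[OF continuous_on_eval]) (use sub in auto)
    then have "continuous_map (top_of_set (S \<times> ?U)) (top_of_set ?U) (\<lambda>(\<phi>, x). \<phi> x)"
      by (auto simp: star_automorphism_unitary aut)
    from continuous_map_compose[OF this continuous_pu]
    show "continuous_map (top_of_set (S \<times> ?U)) PU_top ((\<lambda>(a, c). a ` c) \<circ> (\<lambda>(a, u). (a, pu u)))"
      by (rule continuous_map_eq) (clarsimp simp: aut_pu[OF aut])
  qed
  have inv_S: "inv\<^bsub>Aut\<lparr>carrier := S\<rparr>\<^esub> \<phi> = inv\<^bsub>Aut\<^esub> \<phi>" if "\<phi> \<in> S" for \<phi>
    using group.m_inv_consistent[OF group_Aut S that] .
  have act_hom: "(\<lambda>c. a ` c) \<in> hom PU PU" if "a \<in> S" for a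
    using aut[OF that]
    by (auto simp: hom_def carrier_PU aut_pu star_automorphism_unitary PU_mult unitary_mult
        star_automorphismD(4))
  have eq1: "?b (a ` c) = a \<circ> ?b c \<circ> inv\<^bsub>Aut\<^esub> a" if "a \<in> S" "c \<in> carrier PU" for a c
    using that by (auto simp: carrier_PU aut_pu aut Ad_pu star_automorphism_unitary Ad_conj)
  have eq2: "?b c ` d = c \<otimes>\<^bsub>PU\<^esub> d \<otimes>\<^bsub>PU\<^esub> inv\<^bsub>PU\<^esub> c" if cd: "c \<in> carrier PU" "d \<in> carrier PU" for c d
  proof -
    obtain u v where uv: "c = pu u" "d = pu v" "unitary u" "unitary v"
      using cd unfolding carrier_PU by blast
    have "Ad u v = u * v * star u" by (simp add: Ad_def)
    with uv show ?thesis
      by (simp add: Ad_pu aut_pu[OF star_automorphism_Ad] PU_mult PU_inv unitary_star unitary_mult)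
  qed
  show ?thesis
    unfolding crossed_module_def
    by (simp add: PG_def topological_group_PU topological_group_Aut[OF S] hom cb ca act_hom eq1 eq2
        inv_S image_comp[symmetric] del: image_image)
qed

lemma crossed_module_PG: "crossed_module PG"
proof -
  interpret group Aut by (rule group_Aut)
  have "Inn \<subseteq> carrier Aut" using normal_imp_subgroup[OF normal_Inn] by (rule subgroup.subset)
  from crossed_module_PG_restrict[OF subgroup_self this] show ?thesis
    by (simp add: PG_def Aut_def)
qed

lemma subgroup_Aut_tr: "subgroup (carrier (Aut_tr \<tau>)) Aut"
proof (rule group.subgroupI[OF group_Aut])
  show "carrier (Aut_tr \<tau>) \<noteq> {}"
    by (auto simp: Aut_tr_def star_automorphism_id intro!: exI[of _ id])
  fix a assume "a \<in> carrier (Aut_tr \<tau>)"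
  then have a: "star_automorphism a" "\<tau> \<circ> a = \<tau>" by (auto simp: Aut_tr_def)
  then have "\<tau> \<circ> inv_into UNIV a = \<tau>"
    by (metis bij_is_surj comp_assoc comp_id star_automorphismD(1) surj_iff)
  with a show "inv\<^bsub>Aut\<^esub> a \<in> carrier (Aut_tr \<tau>)"
    by (auto simp: Aut_tr_def inv_Aut star_automorphism_inv)
next
  fix a b assume "a \<in> carrier (Aut_tr \<tau>)" "b \<in> carrier (Aut_tr \<tau>)"
  then show "a \<otimes>\<^bsub>Aut\<^esub> b \<in> carrier (Aut_tr \<tau>)"
    by (auto simp: Aut_tr_def star_automorphism_comp simp flip: comp_assoc)
qed (auto simp: Aut_tr_def)

lemma crossed_module_PG_tr:
  assumes "tracial_state \<tau>"
  shows "crossed_module (PG_tr \<tau>)"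
proof -
  have "\<tau> (Ad u a) = \<tau> a" if "unitary u" for u a
  proof -
    have "\<tau> (u * (a * star u)) = \<tau> (a * star u * u)" using assms by (simp add: tracial_state_def)
    then show ?thesis using that by (simp add: Ad_def mult.assoc unitary_def)
  qed
  then have "Inn \<subseteq> carrier (Aut_tr \<tau>)"
    by (auto simp: Inn_def Aut_tr_def star_automorphism_Ad)
  from crossed_module_PG_restrict[OF subgroup_Aut_tr this] show ?thesis
    by (simp add: PG_tr_def Aut_tr_def)
qed

end

theory Submission
  imports Defs
begin

text \<open>
  An element of \<open>A\<close> that commutes with all unitaries is central, so \<open>Ad\<close> is injective on
  \<open>PU(A)\<close> and identifies this group with \<open>Inn(A)\<close> (\<open>Ad_eq_imp_pu_eq\<close>).  This makes the theorem
  a statement about crossed modules whose boundary map \<open>\<partial>\<close> is the inclusion of a normal subgroup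
  \<open>N\<close>.  In such a crossed module an equation in the domain can be tested after applying \<open>\<partial>\<close>.
  Given \<open>\<alpha>\<close>, the element \<open>u\<^sub>g\<^sub>,\<^sub>h\<close> is therefore determined by
  \<open>\<partial>(u\<^sub>g\<^sub>,\<^sub>h) = \<alpha>\<^sub>g \<alpha>\<^sub>h (\<alpha>\<^sub>g\<^sub>h)\<^sup>-\<^sup>1\<close>; the cocycle identity for \<open>u\<close> follows from associativity
  (\<open>Z1_iff\<close>), and the transformation rule for \<open>u\<close> under a cohomology follows from the one
  for \<open>\<alpha>\<close> (\<open>cohomologous_via_iff\<close>).

  What remains of a cocycle is a map \<open>\<alpha>\<close> that is multiplicative modulo \<open>N\<close>, that is, a set of
  representatives for a homomorphism into the quotient.  Every such homomorphism has
  representatives (\<open>coset_map_surj\<close>).  What remains of a cohomology is an element \<open>\<gamma>\<close> that conjugates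
  one homomorphism into the other modulo \<open>N\<close>, with \<open>w\<^sub>g\<close> recording the factors in \<open>N\<close>.  So two
  cocycles are cohomologous exactly when their kernels are conjugate (\<open>cohom_rel_eq_pullback\<close>), and
  the induced map of quotients is a bijection.  The argument is carried out once, relative to a
  subgroup \<open>S\<close> between \<open>N\<close> and the ambient group; \<open>S = Aut(A)\<close> and \<open>S = Aut\<^sub>\<tau>(A)\<close> give the two
  parts of the theorem.
\<close>


section \<open>Maps induced on quotients\<close>

lemma induced_class:
  assumes R: "equiv A R" and S: "equiv B S" and a: "a \<in> A"
    and resp: "\<And>b. (a, b) \<in> R \<Longrightarrow> (F a, F b) \<in> S"
  shows "induced S F (R `` {a}) = S `` {F a}"
proof -
  have "(\<lambda>x. S `` {F x}) ` (R `` {a}) = (\<lambda>x. S `` {F a}) ` (R `` {a})"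
    by (rule image_cong[OF refl]) (simp add: equiv_class_eq[OF S resp])
  also have "\<dots> = {S `` {F a}}"
    by (rule image_constant[OF equiv_class_self[OF R a]])
  finally have "(\<lambda>x. S `` {F x}) ` (R `` {a}) = {S `` {F a}}" .
  then show ?thesis by (simp add: induced_def)
qed

lemma equiv_pullback:
  assumes S: "equiv B S" and F: "F \<in> A \<rightarrow> B"
    and R: "R = {(x, y) \<in> A \<times> A. (F x, F y) \<in> S}"
  shows "equiv A R"
proof (rule equivI)
  have F: "F x \<in> B" if "x \<in> A" for x using F that by auto
  have S': "refl_on B S" "sym S" "trans S" using S by (simp_all add: equiv_def)
  show "R \<subseteq> A \<times> A" by (auto simp: R)
  show "refl_on A R" by (rule refl_onI) (simp add: R refl_onD[OF S'(1) F])
  show "sym R" by (rule symI) (simp add: R symD[OF S'(2)])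
  show "trans R" by (rule transI) (auto simp: R dest: transD[OF S'(3)])
qed

text \<open>The induced map is injective because \<open>R\<close> identifies exactly those points whose images
  \<open>S\<close> identifies, and it is onto because \<open>F\<close> is.\<close>

lemma bij_betw_induced:
  assumes S: "equiv B S" and F: "F ` A = B"
    and R: "R = {(x, y) \<in> A \<times> A. (F x, F y) \<in> S}"
  shows "bij_betw (induced S F) (A // R) (B // S)"
proof -
  have eR: "equiv A R" by (rule equiv_pullback[OF S _ R]) (use F in auto)
  have ind: "induced S F (R `` {a}) = S `` {F a}" if "a \<in> A" for a
    by (rule induced_class[OF eR S that]) (simp add: R)
  have "inj_on (induced S F) (A // R)"
  proof (rule inj_onI)
    fix C D assume "C \<in> A // R" "D \<in> A // R" and e: "induced S F C = induced S F D"
    then obtain a b where ab: "a \<in> A" "b \<in> A" "C = R `` {a}" "D = R `` {b}"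
      by (auto elim!: quotientE)
    with e have "S `` {F a} = S `` {F b}" by (simp add: ind)
    then have "(F a, F b) \<in> S"
      by (rule eq_equiv_class[OF _ S]) (use ab F in auto)
    with ab(1,2) have "(a, b) \<in> R" by (simp add: R)
    with ab show "C = D" using equiv_class_eq[OF eR] by simp
  qed
  moreover have "induced S F ` (A // R) = B // S"
    by (auto simp: quotient_def ind image_UN simp flip: F)
  ultimately show ?thesis by (simp add: bij_betw_def)
qed


section \<open>Crossed modules with injective boundary map\<close>

lemma hom_simps:
  assumes "f \<in> hom \<Delta> \<Gamma>"
  shows "d \<in> carrier \<Delta> \<Longrightarrow> f d \<in> carrier \<Gamma>"
    and "d \<in> carrier \<Delta> \<Longrightarrow> e \<in> carrier \<Delta> \<Longrightarrow> f (d \<otimes>\<^bsub>\<Delta>\<^esub> e) = f d \<otimes>\<^bsub>\<Gamma>\<^esub> f e"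
  using assms by (simp_all add: hom_mult hom_in_carrier)

lemma (in group) inv_cancel [simp]:
  assumes "x \<in> carrier G" "y \<in> carrier G"
  shows "x \<otimes> (inv x \<otimes> y) = y" "inv x \<otimes> (x \<otimes> y) = y"
  using assms m_assoc[of x "inv x" y, symmetric] m_assoc[of "inv x" x y, symmetric] by simp_all

text \<open>The boundary map identifies the domain of \<open>X\<close> with the normal subgroup \<open>N\<close>.  The subgroup
  \<open>S\<close> is kept apart from \<open>G\<close> because trace-preserving kernels are homomorphisms into
  \<open>Out(A)\<close>, a quotient of the full automorphism group, that only take values in cosets of
  trace-preserving automorphisms.\<close>

locale injective_crossed_module = normal N G for N and G :: "'k monoid" (structure) +
  fixes S :: "'k set" and X :: "('h, 'k) xmod"
  assumes crossed_module: "crossed_module X"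
    and S: "subgroup S G" and N_subset: "N \<subseteq> S"
    and cod: "cod_grp X = G\<lparr>carrier := S\<rparr>"
    and inj_bdry: "inj_on (bdry X) (carrier (dom_grp X))"
    and bdry_image: "bdry X ` carrier (dom_grp X) = N"
begin

definition kernels_in :: "('g, 'm) monoid_scheme \<Rightarrow> ('g \<Rightarrow> 'k set) set" where
  "kernels_in \<Gamma> = {\<kappa> \<in> hom \<Gamma> (G Mod N) \<inter> extensional (carrier \<Gamma>).
     \<forall>g \<in> carrier \<Gamma>. \<kappa> g \<subseteq> S}"

definition conj_in :: "('g, 'm) monoid_scheme \<Rightarrow> ('g \<Rightarrow> 'k set) rel" where
  "conj_in \<Gamma> = {(\<kappa>, \<mu>) \<in> kernels_in \<Gamma> \<times> kernels_in \<Gamma>. \<exists>\<phi> \<in> S. \<forall>g \<in> carrier \<Gamma>.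
     (N #> \<phi>) \<otimes>\<^bsub>G Mod N\<^esub> \<kappa> g \<otimes>\<^bsub>G Mod N\<^esub> inv\<^bsub>G Mod N\<^esub> (N #> \<phi>) = \<mu> g}"

definition coset_map ::
    "('g, 'm) monoid_scheme \<Rightarrow> ('g \<Rightarrow> 'k) \<times> ('g \<times> 'g \<Rightarrow> 'h) \<Rightarrow> 'g \<Rightarrow> 'k set" where
  "coset_map \<Gamma> = (\<lambda>(\<alpha>, u). \<lambda>g \<in> carrier \<Gamma>. N #> \<alpha> g)"

abbreviation H :: "'h monoid" where "H \<equiv> dom_grp X"

abbreviation bd :: "'h \<Rightarrow> 'k" (\<open>\<partial>\<close>) where "\<partial> \<equiv> bdry X"

sublocale Q: group "G Mod N"
  by (rule factorgroup_is_group)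

lemma S_closed [simp]:
  "a \<in> S \<Longrightarrow> a \<in> carrier G" "\<one> \<in> S" "a \<in> S \<Longrightarrow> inv a \<in> S"
  "a \<in> S \<Longrightarrow> b \<in> S \<Longrightarrow> a \<otimes> b \<in> S"
  by (fact subgroup.mem_carrier[OF S] subgroup.one_closed[OF S] subgroup.m_inv_closed[OF S]
      subgroup.m_closed[OF S])+

lemma N_in_S [simp]: "n \<in> N \<Longrightarrow> n \<in> S"
  using N_subset by auto

lemma cod_simps [simp]:
  "carrier (cod_grp X) = S" "mult (cod_grp X) = mult G" "one (cod_grp X) = \<one>"
  "a \<in> S \<Longrightarrow> inv\<^bsub>cod_grp X\<^esub> a = inv a"
  by (simp_all add: cod m_inv_consistent[OF S])

lemma group_dom: "group H"
  using crossed_module by (simp add: crossed_module_def topological_group_def)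

lemma dom_closed [simp]:
  "u \<in> carrier H \<Longrightarrow> v \<in> carrier H \<Longrightarrow> u \<otimes>\<^bsub>H\<^esub> v \<in> carrier H"
  "u \<in> carrier H \<Longrightarrow> inv\<^bsub>H\<^esub> u \<in> carrier H" "\<one>\<^bsub>H\<^esub> \<in> carrier H"
proof -
  interpret H: group H by (rule group_dom)
  show "u \<in> carrier H \<Longrightarrow> v \<in> carrier H \<Longrightarrow> u \<otimes>\<^bsub>H\<^esub> v \<in> carrier H"
    "u \<in> carrier H \<Longrightarrow> inv\<^bsub>H\<^esub> u \<in> carrier H" "\<one>\<^bsub>H\<^esub> \<in> carrier H" by simp_all
qed

lemma act_closed [simp]: "a \<in> S \<Longrightarrow> u \<in> carrier H \<Longrightarrow> act X a u \<in> carrier H"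
  using crossed_module by (auto simp: crossed_module_def hom_def)

lemma bdry_simps [simp]:
  "u \<in> carrier H \<Longrightarrow> \<partial> u \<in> N"
  "u \<in> carrier H \<Longrightarrow> v \<in> carrier H \<Longrightarrow> \<partial> (u \<otimes>\<^bsub>H\<^esub> v) = \<partial> u \<otimes> \<partial> v"
  "u \<in> carrier H \<Longrightarrow> \<partial> (inv\<^bsub>H\<^esub> u) = inv (\<partial> u)"
  "\<partial> \<one>\<^bsub>H\<^esub> = \<one>"
  "a \<in> S \<Longrightarrow> u \<in> carrier H \<Longrightarrow> \<partial> (act X a u) = a \<otimes> \<partial> u \<otimes> inv a"
proof -
  show N: "u \<in> carrier H \<Longrightarrow> \<partial> u \<in> N" for u using bdry_image by auto
  interpret h: group_hom H "cod_grp X" \<partial>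
    using crossed_module
    by (simp add: crossed_module_def topological_group_def group_hom_def group_hom_axioms_def)
  show "u \<in> carrier H \<Longrightarrow> v \<in> carrier H \<Longrightarrow> \<partial> (u \<otimes>\<^bsub>H\<^esub> v) = \<partial> u \<otimes> \<partial> v"
    using h.hom_mult by simp
  show "u \<in> carrier H \<Longrightarrow> \<partial> (inv\<^bsub>H\<^esub> u) = inv (\<partial> u)" using h.hom_inv N by simp
  show "\<partial> \<one>\<^bsub>H\<^esub> = \<one>" using h.hom_one by simp
  show "a \<in> S \<Longrightarrow> u \<in> carrier H \<Longrightarrow> \<partial> (act X a u) = a \<otimes> \<partial> u \<otimes> inv a"
    using crossed_module by (simp add: crossed_module_def)
qed

text \<open>Injectivity enters only here: an equation in the domain may be checked after applying
  \<open>\<partial>\<close>, where it becomes an equation between elements of \<open>S\<close>.\<close>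

lemma bdry_eqD: "\<partial> u = \<partial> v \<Longrightarrow> u \<in> carrier H \<Longrightarrow> v \<in> carrier H \<Longrightarrow> u = v"
  using inj_bdry by (auto dest: inj_onD)

lemma coset_eq_iff:
  assumes "x \<in> carrier G" "y \<in> carrier G"
  shows "N #> x = N #> y \<longleftrightarrow> (\<exists>n \<in> N. y = n \<otimes> x)"
proof
  assume "N #> x = N #> y"
  moreover have "y \<in> N #> y" by (rule rcos_self[OF assms(2) subgroup_axioms])
  ultimately show "\<exists>n \<in> N. y = n \<otimes> x" by (auto simp: r_coset_def)
next
  assume "\<exists>n \<in> N. y = n \<otimes> x"
  then obtain n where n: "n \<in> N" "y = n \<otimes> x" by blast
  then show "N #> x = N #> y"
    using coset_mult_assoc[OF subset _ assms(1), of n] rcos_const[OF is_group n(1)] by simp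
qed

lemma coset_mult: "x \<in> carrier G \<Longrightarrow> y \<in> carrier G \<Longrightarrow>
    (N #> x) \<otimes>\<^bsub>G Mod N\<^esub> (N #> y) = N #> (x \<otimes> y)"
  by (simp add: rcos_sum)

lemma coset_inv: "x \<in> carrier G \<Longrightarrow> inv\<^bsub>G Mod N\<^esub> (N #> x) = N #> inv x"
  by (simp add: inv_FactGroup rcos_inv carrier_FactGroup)

lemma coset_carrier [simp]: "x \<in> carrier G \<Longrightarrow> N #> x \<in> carrier (G Mod N)"
  by (simp add: carrier_FactGroup)

lemma coset_subset_S: "x \<in> S \<Longrightarrow> N #> x \<subseteq> S"
  by (auto simp: r_coset_def)

text \<open>The cocycle identity for \<open>u\<close> follows from the relation between \<open>\<alpha>\<close> and \<open>u\<close>: its two sides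
  have the same boundary, because both boundaries compare \<open>\<alpha>\<^sub>g \<alpha>\<^sub>h \<alpha>\<^sub>k\<close> with \<open>\<alpha>\<^sub>g\<^sub>h\<^sub>k\<close>.\<close>

lemma Z1_iff:
  assumes "group \<Gamma>"
  shows "(\<alpha>, u) \<in> Z1 \<Gamma> X \<longleftrightarrow> \<alpha> \<in> carrier \<Gamma> \<rightarrow>\<^sub>E S
     \<and> u \<in> carrier \<Gamma> \<times> carrier \<Gamma> \<rightarrow>\<^sub>E carrier H
     \<and> (\<forall>g \<in> carrier \<Gamma>. \<forall>h \<in> carrier \<Gamma>. \<alpha> g \<otimes> \<alpha> h = \<partial> (u (g, h)) \<otimes> \<alpha> (g \<otimes>\<^bsub>\<Gamma>\<^esub> h))"
    (is "?L \<longleftrightarrow> ?R")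
proof
  show "?L \<Longrightarrow> ?R" by (simp add: Z1_def)
  assume R: ?R
  interpret \<Gamma>: group \<Gamma> by (rule assms)
  have \<alpha>: "\<alpha> g \<in> S" if "g \<in> carrier \<Gamma>" for g using R that by auto
  have u: "u (g, h) \<in> carrier H" if "g \<in> carrier \<Gamma>" "h \<in> carrier \<Gamma>" for g h
    using R that by auto
  have rel: "\<alpha> g \<otimes> \<alpha> h = \<partial> (u (g, h)) \<otimes> \<alpha> (g \<otimes>\<^bsub>\<Gamma>\<^esub> h)"
    if "g \<in> carrier \<Gamma>" "h \<in> carrier \<Gamma>" for g h using R that by blast
  have "act X (\<alpha> g) (u (h, k)) \<otimes>\<^bsub>H\<^esub> u (g, h \<otimes>\<^bsub>\<Gamma>\<^esub> k) = u (g, h) \<otimes>\<^bsub>H\<^esub> u (g \<otimes>\<^bsub>\<Gamma>\<^esub> h, k)"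
    if g: "g \<in> carrier \<Gamma>" and h: "h \<in> carrier \<Gamma>" and k: "k \<in> carrier \<Gamma>" for g h k
  proof (rule bdry_eqD)
    let ?a = "\<alpha> (g \<otimes>\<^bsub>\<Gamma>\<^esub> (h \<otimes>\<^bsub>\<Gamma>\<^esub> k))"
    note cl = g h k \<alpha> u
    \<comment> \<open>Multiplied by \<open>\<alpha>\<^sub>g\<^sub>h\<^sub>k\<close> on the right, both boundaries become \<open>\<alpha>\<^sub>g \<alpha>\<^sub>h \<alpha>\<^sub>k\<close>.\<close>
    have "(\<alpha> g \<otimes> \<partial> (u (h, k)) \<otimes> inv (\<alpha> g) \<otimes> \<partial> (u (g, h \<otimes>\<^bsub>\<Gamma>\<^esub> k))) \<otimes> ?a
        = \<alpha> g \<otimes> \<partial> (u (h, k)) \<otimes> inv (\<alpha> g) \<otimes> (\<alpha> g \<otimes> \<alpha> (h \<otimes>\<^bsub>\<Gamma>\<^esub> k))"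
      by (simp add: cl m_assoc rel[of g "h \<otimes>\<^bsub>\<Gamma>\<^esub> k"])
    also have "\<dots> = \<alpha> g \<otimes> (\<partial> (u (h, k)) \<otimes> \<alpha> (h \<otimes>\<^bsub>\<Gamma>\<^esub> k))"
      by (simp add: cl m_assoc)
    also have "\<dots> = \<alpha> g \<otimes> (\<alpha> h \<otimes> \<alpha> k)" by (simp add: rel[OF h k])
    also have "\<dots> = (\<partial> (u (g, h)) \<otimes> \<alpha> (g \<otimes>\<^bsub>\<Gamma>\<^esub> h)) \<otimes> \<alpha> k"
      by (simp add: cl rel[OF g h, symmetric] m_assoc)
    also have "\<dots> = (\<partial> (u (g, h)) \<otimes> \<partial> (u (g \<otimes>\<^bsub>\<Gamma>\<^esub> h, k))) \<otimes> ?a"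
      using rel[of "g \<otimes>\<^bsub>\<Gamma>\<^esub> h" k] by (simp add: cl m_assoc \<Gamma>.m_assoc)
    finally have "\<alpha> g \<otimes> \<partial> (u (h, k)) \<otimes> inv (\<alpha> g) \<otimes> \<partial> (u (g, h \<otimes>\<^bsub>\<Gamma>\<^esub> k))
        = \<partial> (u (g, h)) \<otimes> \<partial> (u (g \<otimes>\<^bsub>\<Gamma>\<^esub> h, k))"
      by (rule right_cancel[THEN iffD1, rotated 3]) (simp_all add: cl)
    then show "\<partial> (act X (\<alpha> g) (u (h, k)) \<otimes>\<^bsub>H\<^esub> u (g, h \<otimes>\<^bsub>\<Gamma>\<^esub> k))
        = \<partial> (u (g, h) \<otimes>\<^bsub>H\<^esub> u (g \<otimes>\<^bsub>\<Gamma>\<^esub> h, k))"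
      by (simp add: cl)
  qed (simp_all add: g h k \<alpha> u)
  with R show ?L by (simp add: Z1_def)
qed

lemma coset_map_kernel:
  assumes "group \<Gamma>" and c: "c \<in> Z1 \<Gamma> X"
  shows "coset_map \<Gamma> c \<in> kernels_in \<Gamma>"
proof -
  interpret \<Gamma>: group \<Gamma> by (rule assms)
  obtain \<alpha> u where c': "c = (\<alpha>, u)" by (cases c)
  note Z = c[unfolded c' Z1_iff[OF assms(1)]]
  have \<alpha>: "\<alpha> g \<in> S" if "g \<in> carrier \<Gamma>" for g using Z that by auto
  have "N #> \<alpha> (g \<otimes>\<^bsub>\<Gamma>\<^esub> h) = N #> (\<alpha> g \<otimes> \<alpha> h)" if "g \<in> carrier \<Gamma>" "h \<in> carrier \<Gamma>" for g h
  proof -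
    have "u (g, h) \<in> carrier H" using Z that by auto
    then show ?thesis using Z that by (subst coset_eq_iff) (auto simp: \<alpha>)
  qed
  then show ?thesis
    by (auto simp: c' coset_map_def kernels_in_def hom_def \<alpha> coset_mult
        dest: coset_subset_S[OF \<alpha>, THEN subsetD] simp del: mult_FactGroup)
qed

text \<open>A kernel is lifted to a cocycle by choosing a representative of each coset and then, since
  \<open>N\<close> is the image of the boundary map, an element of the domain that corrects the failure of
  multiplicativity.\<close>

lemma coset_map_surj:
  assumes "group \<Gamma>" and \<kappa>: "\<kappa> \<in> kernels_in \<Gamma>"
  obtains c where "c \<in> Z1 \<Gamma> X" "coset_map \<Gamma> c = \<kappa>"
proof -
  interpret \<Gamma>: group \<Gamma> by (rule assms)
  have "\<exists>a \<in> S. N #> a = \<kappa> g" if g: "g \<in> carrier \<Gamma>" for g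
  proof -
    have "\<kappa> g \<in> carrier (G Mod N)" "\<kappa> g \<subseteq> S"
      using \<kappa> g by (auto simp: kernels_in_def hom_def)
    then obtain a where "a \<in> carrier G" "\<kappa> g = N #> a" "a \<in> S"
      using rcos_self[OF _ subgroup_axioms] by (auto simp: carrier_FactGroup)
    then show ?thesis by blast
  qed
  then obtain a where a: "\<And>g. g \<in> carrier \<Gamma> \<Longrightarrow> a g \<in> S \<and> N #> a g = \<kappa> g" by metis
  have "\<exists>v \<in> carrier H. a g \<otimes> a h = \<partial> v \<otimes> a (g \<otimes>\<^bsub>\<Gamma>\<^esub> h)"
    if "g \<in> carrier \<Gamma>" "h \<in> carrier \<Gamma>" for g h
  proof -
    have "\<kappa> (g \<otimes>\<^bsub>\<Gamma>\<^esub> h) = \<kappa> g \<otimes>\<^bsub>G Mod N\<^esub> \<kappa> h"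
      using \<kappa> that by (simp add: kernels_in_def hom_def)
    then have "N #> a (g \<otimes>\<^bsub>\<Gamma>\<^esub> h) = N #> (a g \<otimes> a h)"
      using that a coset_mult[of "a g" "a h"] by simp
    then have "\<exists>n \<in> N. a g \<otimes> a h = n \<otimes> a (g \<otimes>\<^bsub>\<Gamma>\<^esub> h)"
      using that a by (subst (asm) coset_eq_iff) auto
    then show ?thesis by (auto simp flip: bdry_image)
  qed
  then obtain v where v: "\<And>g h. g \<in> carrier \<Gamma> \<Longrightarrow> h \<in> carrier \<Gamma> \<Longrightarrow>
      v g h \<in> carrier H \<and> a g \<otimes> a h = \<partial> (v g h) \<otimes> a (g \<otimes>\<^bsub>\<Gamma>\<^esub> h)"
    by metis
  let ?c = "(restrict a (carrier \<Gamma>), \<lambda>(g, h) \<in> carrier \<Gamma> \<times> carrier \<Gamma>. v g h)"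
  show thesis
  proof (rule that[of ?c])
    show "?c \<in> Z1 \<Gamma> X" by (subst Z1_iff[OF assms(1)]) (use a v in auto)
    have "\<kappa> \<in> extensional (carrier \<Gamma>)" using \<kappa> by (simp add: kernels_in_def)
    then show "coset_map \<Gamma> ?c = \<kappa>"
      by (intro extensionalityI[of _ "carrier \<Gamma>"]) (auto simp: coset_map_def a)
  qed
qed

lemma coset_map_image: "group \<Gamma> \<Longrightarrow> coset_map \<Gamma> ` Z1 \<Gamma> X = kernels_in \<Gamma>"
  using coset_map_kernel coset_map_surj by (intro equalityI image_subsetI subsetI) (assumption | blast)+

text \<open>The relation is the orbit relation of conjugation by the cosets of elements of \<open>S\<close>, and
  these cosets form a subgroup of \<open>G Mod N\<close>.\<close>

lemma equiv_conj: "equiv (kernels_in \<Gamma>) (conj_in \<Gamma>)"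
proof (rule equivI)
  have Q: "\<kappa> g \<in> carrier (G Mod N)" if "\<kappa> \<in> kernels_in \<Gamma>" "g \<in> carrier \<Gamma>" for \<kappa> g
    using that by (auto simp: kernels_in_def hom_def)
  show "conj_in \<Gamma> \<subseteq> kernels_in \<Gamma> \<times> kernels_in \<Gamma>" by (auto simp: conj_in_def)
  show "refl_on (kernels_in \<Gamma>) (conj_in \<Gamma>)"
  proof (rule refl_onI)
    fix \<kappa> assume \<kappa>: "\<kappa> \<in> kernels_in \<Gamma>"
    have "N #> \<one> = \<one>\<^bsub>G Mod N\<^esub>" using coset_mult_one[OF subset] by simp
    then have "(N #> \<one>) \<otimes>\<^bsub>G Mod N\<^esub> \<kappa> g \<otimes>\<^bsub>G Mod N\<^esub> inv\<^bsub>G Mod N\<^esub> (N #> \<one>) = \<kappa> g"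
      if "g \<in> carrier \<Gamma>" for g
      using Q[OF \<kappa> that] Q.inv_one Q.r_one Q.l_one by metis
    with \<kappa> show "(\<kappa>, \<kappa>) \<in> conj_in \<Gamma>"
      by (auto simp: conj_in_def simp del: mult_FactGroup intro!: bexI[of _ \<one>])
  qed
  show "sym (conj_in \<Gamma>)"
  proof (rule symI)
    fix \<kappa> \<mu> assume "(\<kappa>, \<mu>) \<in> conj_in \<Gamma>"
    then obtain \<phi> where \<phi>: "\<phi> \<in> S" and k: "\<kappa> \<in> kernels_in \<Gamma>" "\<mu> \<in> kernels_in \<Gamma>"
      and e: "\<And>g. g \<in> carrier \<Gamma> \<Longrightarrow>
        (N #> \<phi>) \<otimes>\<^bsub>G Mod N\<^esub> \<kappa> g \<otimes>\<^bsub>G Mod N\<^esub> inv\<^bsub>G Mod N\<^esub> (N #> \<phi>) = \<mu> g"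
      unfolding conj_in_def by blast
    have "(N #> inv \<phi>) \<otimes>\<^bsub>G Mod N\<^esub> \<mu> g \<otimes>\<^bsub>G Mod N\<^esub> inv\<^bsub>G Mod N\<^esub> (N #> inv \<phi>) = \<kappa> g"
      if g: "g \<in> carrier \<Gamma>" for g
    proof -
      let ?p = "N #> \<phi>"
      have p: "?p \<in> carrier (G Mod N)" using \<phi> by simp
      have "N #> inv \<phi> = inv\<^bsub>G Mod N\<^esub> ?p" using \<phi> by (simp add: coset_inv)
      then show ?thesis
        unfolding e[OF g, symmetric] using p Q[OF k(1) g]
        by (simp add: Q.m_assoc del: mult_FactGroup one_FactGroup)
    qed
    with \<phi> k show "(\<mu>, \<kappa>) \<in> conj_in \<Gamma>"
      by (auto simp: conj_in_def simp del: mult_FactGroup intro!: bexI[of _ "inv \<phi>"])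
  qed
  show "trans (conj_in \<Gamma>)"
  proof (rule transI)
    fix \<kappa> \<mu> \<nu> assume "(\<kappa>, \<mu>) \<in> conj_in \<Gamma>" "(\<mu>, \<nu>) \<in> conj_in \<Gamma>"
    then obtain \<phi> \<psi> where \<phi>: "\<phi> \<in> S" "\<psi> \<in> S" and k: "\<kappa> \<in> kernels_in \<Gamma>" "\<nu> \<in> kernels_in \<Gamma>"
      and e: "\<And>g. g \<in> carrier \<Gamma> \<Longrightarrow>
          (N #> \<phi>) \<otimes>\<^bsub>G Mod N\<^esub> \<kappa> g \<otimes>\<^bsub>G Mod N\<^esub> inv\<^bsub>G Mod N\<^esub> (N #> \<phi>) = \<mu> g"
        "\<And>g. g \<in> carrier \<Gamma> \<Longrightarrow>
          (N #> \<psi>) \<otimes>\<^bsub>G Mod N\<^esub> \<mu> g \<otimes>\<^bsub>G Mod N\<^esub> inv\<^bsub>G Mod N\<^esub> (N #> \<psi>) = \<nu> g"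
      unfolding conj_in_def by blast
    have "(N #> (\<psi> \<otimes> \<phi>)) \<otimes>\<^bsub>G Mod N\<^esub> \<kappa> g \<otimes>\<^bsub>G Mod N\<^esub> inv\<^bsub>G Mod N\<^esub> (N #> (\<psi> \<otimes> \<phi>)) = \<nu> g"
      if g: "g \<in> carrier \<Gamma>" for g
    proof -
      let ?p = "N #> \<phi>" and ?q = "N #> \<psi>"
      have p: "?p \<in> carrier (G Mod N)" "?q \<in> carrier (G Mod N)"
        using \<phi> by simp_all
      have "N #> (\<psi> \<otimes> \<phi>) = ?q \<otimes>\<^bsub>G Mod N\<^esub> ?p" using \<phi> by (simp add: coset_mult del: mult_FactGroup)
      then show ?thesis
        unfolding e(2)[OF g, symmetric] e(1)[OF g, symmetric] using p Q[OF k(1) g]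
        by (simp add: Q.m_assoc Q.inv_mult_group del: mult_FactGroup)
    qed
    with \<phi> k show "(\<kappa>, \<nu>) \<in> conj_in \<Gamma>"
      by (auto simp: conj_in_def simp del: mult_FactGroup intro!: bexI[of _ "\<psi> \<otimes> \<phi>"])
  qed
qed

text \<open>If \<open>\<alpha>\<^sup>1\<^sub>g = \<partial>(w\<^sub>g) \<gamma> \<alpha>\<^sup>0\<^sub>g \<gamma>\<^sup>-\<^sup>1\<close> for all \<open>g\<close>, then the transformation rule for the second
  components holds as well: both of its sides have boundary
  \<open>\<alpha>\<^sup>1\<^sub>g \<alpha>\<^sup>1\<^sub>h (\<alpha>\<^sup>1\<^sub>g\<^sub>h)\<^sup>-\<^sup>1\<close>.\<close>

lemma cohomologous_via_iff:
  assumes "group \<Gamma>" and Z: "(\<alpha>0, u0) \<in> Z1 \<Gamma> X" "(\<alpha>1, u1) \<in> Z1 \<Gamma> X"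
    and \<gamma>: "\<gamma> \<in> S" and w: "w \<in> carrier \<Gamma> \<rightarrow> carrier H"
  shows "cohomologous_via \<Gamma> X \<gamma> w (\<alpha>0, u0) (\<alpha>1, u1) \<longleftrightarrow>
    (\<forall>g \<in> carrier \<Gamma>. \<alpha>1 g = \<partial> (w g) \<otimes> (\<gamma> \<otimes> \<alpha>0 g \<otimes> inv \<gamma>))"
proof -
  interpret \<Gamma>: group \<Gamma> by (rule assms)
  note Z' = Z[unfolded Z1_iff[OF assms(1)]]
  have \<alpha>: "\<alpha>0 g \<in> S" "\<alpha>1 g \<in> S" "w g \<in> carrier H" if "g \<in> carrier \<Gamma>" for g
    using Z' w that by auto
  have u: "u0 (g, h) \<in> carrier H" "u1 (g, h) \<in> carrier H"
    if "g \<in> carrier \<Gamma>" "h \<in> carrier \<Gamma>" for g h using Z' that by auto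
  have bu: "\<partial> (u0 (g, h)) = \<alpha>0 g \<otimes> \<alpha>0 h \<otimes> inv (\<alpha>0 (g \<otimes>\<^bsub>\<Gamma>\<^esub> h))"
      "\<partial> (u1 (g, h)) = \<alpha>1 g \<otimes> \<alpha>1 h \<otimes> inv (\<alpha>1 (g \<otimes>\<^bsub>\<Gamma>\<^esub> h))"
    if "g \<in> carrier \<Gamma>" "h \<in> carrier \<Gamma>" for g h
  proof -
    have "\<alpha>0 g \<otimes> \<alpha>0 h = \<partial> (u0 (g, h)) \<otimes> \<alpha>0 (g \<otimes>\<^bsub>\<Gamma>\<^esub> h)"
      "\<alpha>1 g \<otimes> \<alpha>1 h = \<partial> (u1 (g, h)) \<otimes> \<alpha>1 (g \<otimes>\<^bsub>\<Gamma>\<^esub> h)" using Z' that by blast+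
    then show "\<partial> (u0 (g, h)) = \<alpha>0 g \<otimes> \<alpha>0 h \<otimes> inv (\<alpha>0 (g \<otimes>\<^bsub>\<Gamma>\<^esub> h))"
      "\<partial> (u1 (g, h)) = \<alpha>1 g \<otimes> \<alpha>1 h \<otimes> inv (\<alpha>1 (g \<otimes>\<^bsub>\<Gamma>\<^esub> h))"
      by (subst inv_solve_right; use that \<alpha> u in simp)+
  qed
  have "u1 (g, h) = w g \<otimes>\<^bsub>H\<^esub> act X \<gamma> (act X (\<alpha>0 g) (act X (inv \<gamma>) (w h)) \<otimes>\<^bsub>H\<^esub> u0 (g, h))
      \<otimes>\<^bsub>H\<^esub> inv\<^bsub>H\<^esub> (w (g \<otimes>\<^bsub>\<Gamma>\<^esub> h))"
    if e: "\<forall>g \<in> carrier \<Gamma>. \<alpha>1 g = \<partial> (w g) \<otimes> (\<gamma> \<otimes> \<alpha>0 g \<otimes> inv \<gamma>)"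
      and g: "g \<in> carrier \<Gamma>" and h: "h \<in> carrier \<Gamma>" for g h
    by (rule bdry_eqD)
      (simp_all add: g h \<alpha> u \<gamma> bu e[rule_format] m_assoc inv_mult_group)
  then show ?thesis
    unfolding cohomologous_via_def using \<alpha> \<gamma> by (auto simp: m_assoc)
qed

text \<open>Both sides ask for some \<open>\<gamma> \<in> S\<close> such that every \<open>\<alpha>\<^sup>1\<^sub>g\<close> agrees with
  \<open>\<gamma> \<alpha>\<^sup>0\<^sub>g \<gamma>\<^sup>-\<^sup>1\<close> up to a factor in \<open>N\<close>.  Cohomology asks for this factor as a
  boundary \<open>\<partial>(w\<^sub>g)\<close>, and conjugacy leaves it implicit in the equality of cosets.\<close>

lemma cohom_rel_eq_pullback:
  assumes "group \<Gamma>"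
  shows "cohom_rel \<Gamma> X = {(c0, c1) \<in> Z1 \<Gamma> X \<times> Z1 \<Gamma> X. (coset_map \<Gamma> c0, coset_map \<Gamma> c1) \<in> conj_in \<Gamma>}"
proof -
  have "(c0, c1) \<in> cohom_rel \<Gamma> X \<longleftrightarrow> (coset_map \<Gamma> c0, coset_map \<Gamma> c1) \<in> conj_in \<Gamma>"
    if c: "c0 \<in> Z1 \<Gamma> X" "c1 \<in> Z1 \<Gamma> X" for c0 c1
  proof -
    obtain \<alpha>0 u0 \<alpha>1 u1 where c': "c0 = (\<alpha>0, u0)" "c1 = (\<alpha>1, u1)" by (cases c0, cases c1)
    note Z = c[unfolded c']
    have \<alpha>: "\<alpha>0 g \<in> S" "\<alpha>1 g \<in> S" if "g \<in> carrier \<Gamma>" for g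
      using Z[unfolded Z1_iff[OF assms]] that by auto
    have coh: "(\<exists>w \<in> carrier \<Gamma> \<rightarrow> carrier H. cohomologous_via \<Gamma> X \<gamma> w c0 c1) \<longleftrightarrow>
        (\<forall>g \<in> carrier \<Gamma>. \<exists>n \<in> N. \<alpha>1 g = n \<otimes> (\<gamma> \<otimes> \<alpha>0 g \<otimes> inv \<gamma>))" if \<gamma>: "\<gamma> \<in> S" for \<gamma>
    proof -
      have "(\<exists>w \<in> carrier \<Gamma> \<rightarrow> carrier H. cohomologous_via \<Gamma> X \<gamma> w c0 c1) \<longleftrightarrow>
        (\<exists>w \<in> carrier \<Gamma> \<rightarrow> carrier H. \<forall>g \<in> carrier \<Gamma>. \<alpha>1 g = \<partial> (w g) \<otimes> (\<gamma> \<otimes> \<alpha>0 g \<otimes> inv \<gamma>))"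
        by (simp add: c' cohomologous_via_iff[OF assms Z \<gamma>])
      \<comment> \<open>The choice of \<open>w\<^sub>g\<close> for different \<open>g\<close> is independent.\<close>
      also have "\<dots> \<longleftrightarrow> (\<forall>g \<in> carrier \<Gamma>. \<exists>v \<in> carrier H. \<alpha>1 g = \<partial> v \<otimes> (\<gamma> \<otimes> \<alpha>0 g \<otimes> inv \<gamma>))"
        unfolding Pi_def Bex_def Ball_def mem_Collect_eq by metis
      also have "\<dots> \<longleftrightarrow> (\<forall>g \<in> carrier \<Gamma>. \<exists>n \<in> N. \<alpha>1 g = n \<otimes> (\<gamma> \<otimes> \<alpha>0 g \<otimes> inv \<gamma>))"
        by (simp flip: bdry_image)
      finally show ?thesis .
    qed
    have con: "(N #> \<gamma>) \<otimes>\<^bsub>G Mod N\<^esub> coset_map \<Gamma> c0 g \<otimes>\<^bsub>G Mod N\<^esub> inv\<^bsub>G Mod N\<^esub> (N #> \<gamma>) = coset_map \<Gamma> c1 g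
        \<longleftrightarrow> (\<exists>n \<in> N. \<alpha>1 g = n \<otimes> (\<gamma> \<otimes> \<alpha>0 g \<otimes> inv \<gamma>))" if "\<gamma> \<in> S" "g \<in> carrier \<Gamma>" for \<gamma> g
      using that \<alpha>
      by (simp add: c' coset_map_def coset_mult coset_inv coset_eq_iff del: mult_FactGroup)
    show ?thesis
      using c coset_map_kernel[OF assms c(1)] coset_map_kernel[OF assms c(2)]
      by (simp add: cohom_rel_def conj_in_def coh con del: mult_FactGroup)
  qed
  moreover have "cohom_rel \<Gamma> X \<subseteq> Z1 \<Gamma> X \<times> Z1 \<Gamma> X" by (auto simp: cohom_rel_def)
  ultimately show ?thesis
    unfolding set_eq_iff split_paired_All mem_Collect_eq prod.case by blast
qed

lemma equiv_cohom_rel: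
  assumes "group \<Gamma>"
  shows "equiv (Z1 \<Gamma> X) (cohom_rel \<Gamma> X)"
proof (rule equiv_pullback[where F = "coset_map \<Gamma>"])
  show "coset_map \<Gamma> \<in> Z1 \<Gamma> X \<rightarrow> kernels_in \<Gamma>"
    by (rule funcsetI) (rule coset_map_kernel[OF assms])
qed (rule equiv_conj cohom_rel_eq_pullback[OF assms])+

lemma cohom_rel_iff:
  assumes "group \<Gamma>"
  shows "(c0, c1) \<in> cohom_rel \<Gamma> X \<longleftrightarrow> c0 \<in> Z1 \<Gamma> X \<and> c1 \<in> Z1 \<Gamma> X
    \<and> (coset_map \<Gamma> c0, coset_map \<Gamma> c1) \<in> conj_in \<Gamma>"
  by (subst cohom_rel_eq_pullback[OF assms]) simp

lemma induced_coset_map: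
  assumes "group \<Gamma>" "c \<in> Z1 \<Gamma> X"
  shows "induced (conj_in \<Gamma>) (coset_map \<Gamma>) (cohom_rel \<Gamma> X `` {c}) = conj_in \<Gamma> `` {coset_map \<Gamma> c}"
proof (rule induced_class)
  show "(coset_map \<Gamma> c, coset_map \<Gamma> b) \<in> conj_in \<Gamma>" if "(c, b) \<in> cohom_rel \<Gamma> X" for b
    using that by (simp add: cohom_rel_iff[OF assms(1)])
qed (rule equiv_cohom_rel equiv_conj assms)+

lemma bij_betw_H1_kernels:
  assumes "group \<Gamma>"
  shows "bij_betw (induced (conj_in \<Gamma>) (coset_map \<Gamma>)) (H1 \<Gamma> X) (kernels_in \<Gamma> // conj_in \<Gamma>)"
  unfolding H1_def
  by (rule bij_betw_induced[OF equiv_conj coset_map_image[OF assms] cohom_rel_eq_pullback[OF assms]])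

lemma trivial_cocycle_Z1:
  assumes "group \<Gamma>"
  shows "trivial_cocycle \<Gamma> X \<in> Z1 \<Gamma> X"
proof -
  interpret \<Gamma>: group \<Gamma> by (rule assms)
  show ?thesis by (simp add: trivial_cocycle_def Z1_iff[OF assms])
qed

lemma coset_map_trivial: "coset_map \<Gamma> (trivial_cocycle \<Gamma> X) = (\<lambda>g \<in> carrier \<Gamma>. \<one>\<^bsub>G Mod N\<^esub>)"
  unfolding coset_map_def trivial_cocycle_def prod.case
  by (rule restrict_ext) (simp add: coset_mult_one[OF subset])

lemma pull_cocycle_Z1:
  assumes "group \<Gamma>" "group \<Delta>" "f \<in> hom \<Delta> \<Gamma>" "c \<in> Z1 \<Gamma> X"
  shows "pull_cocycle \<Delta> f c \<in> Z1 \<Delta> X"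
proof -
  interpret \<Delta>: group \<Delta> by (rule assms)
  obtain \<alpha> u where c: "c = (\<alpha>, u)" by (cases c)
  note f = hom_simps[OF assms(3)]
  from assms(4) have Z: "\<alpha> \<in> carrier \<Gamma> \<rightarrow>\<^sub>E S" "u \<in> carrier \<Gamma> \<times> carrier \<Gamma> \<rightarrow>\<^sub>E carrier H"
    "\<And>g h. g \<in> carrier \<Gamma> \<Longrightarrow> h \<in> carrier \<Gamma> \<Longrightarrow> \<alpha> g \<otimes> \<alpha> h = \<partial> (u (g, h)) \<otimes> \<alpha> (g \<otimes>\<^bsub>\<Gamma>\<^esub> h)"
    unfolding c Z1_iff[OF assms(1)] by blast+
  show ?thesis
    unfolding c pull_cocycle_def pull_map_def prod.case Z1_iff[OF assms(2)]
  proof (intro conjI ballI)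
    show "(\<lambda>d \<in> carrier \<Delta>. \<alpha> (f d)) \<in> carrier \<Delta> \<rightarrow>\<^sub>E S"
      using PiE_mem[OF Z(1)] f by simp
    show "(\<lambda>(d, e) \<in> carrier \<Delta> \<times> carrier \<Delta>. u (f d, f e)) \<in> carrier \<Delta> \<times> carrier \<Delta> \<rightarrow>\<^sub>E carrier H"
      using PiE_mem[OF Z(2)] f by (simp add: case_prod_unfold Pi_iff mem_Times_iff)
  qed (simp add: f Z(3))
qed

lemma coset_map_pull:
  assumes "f \<in> hom \<Delta> \<Gamma>"
  shows "coset_map \<Delta> (pull_cocycle \<Delta> f c) = pull_map \<Delta> f (coset_map \<Gamma> c)"
  unfolding coset_map_def pull_cocycle_def pull_map_def case_prod_unfold fst_conv
  by (rule restrict_ext) (simp add: hom_simps[OF assms])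

lemma pull_map_conj:
  assumes f: "f \<in> hom \<Delta> \<Gamma>" and D: "group \<Delta>"
    and k: "(\<kappa>, \<mu>) \<in> conj_in \<Gamma>"
  shows "(pull_map \<Delta> f \<kappa>, pull_map \<Delta> f \<mu>) \<in> conj_in \<Delta>"
proof -
  interpret \<Delta>: group \<Delta> by (rule D)
  note f' = hom_simps[OF f]
  have "pull_map \<Delta> f \<kappa> \<in> kernels_in \<Delta>" if "\<kappa> \<in> kernels_in \<Gamma>" for \<kappa>
    using that f' by (auto simp: kernels_in_def pull_map_def hom_def Pi_iff
        simp del: mult_FactGroup)
  then show ?thesis
    using k f'(1) unfolding conj_in_def
    by (auto simp: pull_map_def simp del: mult_FactGroup intro!: bexI)
qed

lemma induced_coset_map_natural:
  assumes "group \<Gamma>" "group \<Delta>" "f \<in> hom \<Delta> \<Gamma>" "x \<in> H1 \<Gamma> X"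
  shows "induced (conj_in \<Delta>) (coset_map \<Delta>) (induced (cohom_rel \<Delta> X) (pull_cocycle \<Delta> f) x)
    = induced (conj_in \<Delta>) (pull_map \<Delta> f) (induced (conj_in \<Gamma>) (coset_map \<Gamma>) x)"
proof -
  obtain c where c: "c \<in> Z1 \<Gamma> X" "x = cohom_rel \<Gamma> X `` {c}"
    using assms(4) by (auto simp: H1_def elim!: quotientE)
  have pull_rel: "(pull_cocycle \<Delta> f c, pull_cocycle \<Delta> f c') \<in> cohom_rel \<Delta> X"
    if "(c, c') \<in> cohom_rel \<Gamma> X" for c'
    using that pull_cocycle_Z1[OF assms(1-3)] pull_map_conj[OF assms(3,2)]
    by (simp add: cohom_rel_iff[OF assms(1)] cohom_rel_iff[OF assms(2)] coset_map_pull[OF assms(3)])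
  have "induced (cohom_rel \<Delta> X) (pull_cocycle \<Delta> f) x = cohom_rel \<Delta> X `` {pull_cocycle \<Delta> f c}"
    unfolding c(2)
    by (rule induced_class[where F = "pull_cocycle \<Delta> f"])
      (rule equiv_cohom_rel assms(1,2) c(1) pull_rel | assumption)+
  moreover have "induced (conj_in \<Delta>) (pull_map \<Delta> f) (conj_in \<Gamma> `` {coset_map \<Gamma> c})
      = conj_in \<Delta> `` {pull_map \<Delta> f (coset_map \<Gamma> c)}"
    by (rule induced_class[where F = "pull_map \<Delta> f"])
      (rule equiv_conj coset_map_kernel[OF assms(1) c(1)] pull_map_conj[OF assms(3,2)] | assumption)+
  ultimately show ?thesis
    by (simp add: c induced_coset_map assms pull_cocycle_Z1[OF assms(1-3) c(1)]
        coset_map_pull[OF assms(3)])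
qed

text \<open>The cohomology classes are the conjugacy classes, because the map from cocycles to kernels
  is onto and the cohomology relation is the pullback of conjugacy along it; pulling back along a
  homomorphism \<open>\<Delta> \<rightarrow> \<Gamma>\<close> already commutes with that map on representatives.\<close>

theorem H1_isomorphism:
  fixes \<Gamma> :: "('g, 'm) monoid_scheme"
  assumes \<Gamma>: "group \<Gamma>"
  shows "let \<Phi> = induced (conj_in \<Gamma>) (coset_map \<Gamma>)
    in (\<forall>c \<in> Z1 \<Gamma> X. coset_map \<Gamma> c \<in> kernels_in \<Gamma>
           \<and> \<Phi> (cohom_rel \<Gamma> X `` {c}) = conj_in \<Gamma> `` {coset_map \<Gamma> c})
       \<and> bij_betw \<Phi> (H1 \<Gamma> X) (kernels_in \<Gamma> // conj_in \<Gamma>)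
       \<and> \<Phi> (cohom_rel \<Gamma> X `` {trivial_cocycle \<Gamma> X})
           = conj_in \<Gamma> `` {\<lambda>g \<in> carrier \<Gamma>. \<one>\<^bsub>G Mod N\<^esub>}
       \<and> (\<forall>(\<Delta> :: ('d, 'n) monoid_scheme) f. group \<Delta> \<longrightarrow> f \<in> hom \<Delta> \<Gamma> \<longrightarrow>
            (\<forall>x \<in> H1 \<Gamma> X.
               induced (conj_in \<Delta>) (coset_map \<Delta>)
                   (induced (cohom_rel \<Delta> X) (pull_cocycle \<Delta> f) x)
                 = induced (conj_in \<Delta>) (pull_map \<Delta> f) (\<Phi> x)))"
  unfolding Let_def
proof (intro conjI ballI allI impI)
  show "coset_map \<Gamma> c \<in> kernels_in \<Gamma>"
    "induced (conj_in \<Gamma>) (coset_map \<Gamma>) (cohom_rel \<Gamma> X `` {c}) = conj_in \<Gamma> `` {coset_map \<Gamma> c}"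
    if "c \<in> Z1 \<Gamma> X" for c
    using that by (rule coset_map_kernel[OF \<Gamma>] induced_coset_map[OF \<Gamma>])+
  show "induced (conj_in \<Gamma>) (coset_map \<Gamma>) (cohom_rel \<Gamma> X `` {trivial_cocycle \<Gamma> X})
      = conj_in \<Gamma> `` {\<lambda>g \<in> carrier \<Gamma>. \<one>\<^bsub>G Mod N\<^esub>}"
    using induced_coset_map[OF \<Gamma> trivial_cocycle_Z1[OF \<Gamma>]] unfolding coset_map_trivial .
qed (rule bij_betw_H1_kernels[OF \<Gamma>] induced_coset_map_natural[OF \<Gamma>] | assumption)+

end


section \<open>The crossed modules of a C*-algebra\<close>

text \<open>If \<open>Ad u = Ad v\<close>, then \<open>Ad (u v\<^sup>*)\<close> is the identity, so the unitary \<open>u v\<^sup>*\<close> is central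
  in \<open>A\<close>.\<close>

lemma Ad_eq_imp_pu_eq:
  assumes u: "unitary u" and v: "unitary v" and e: "Ad u = Ad v"
  shows "pu u = pu v"
proof -
  let ?z = "u * star v"
  have uv: "unitary ?z" by (simp add: u v unitary_mult unitary_star)
  have "Ad ?z = id"
    unfolding Ad_mult e using v by (simp add: Ad_one unitary_def flip: Ad_mult)
  then have conj: "?z * a * star ?z = a" for a by (metis Ad_def id_apply)
  have "?z * a = a * ?z" for a
  proof -
    have "?z * a = ?z * a * (star ?z * ?z)" using uv by (simp only: unitary_def mult_1_right)
    also have "\<dots> = (?z * a * star ?z) * ?z" by (simp only: mult.assoc)
    finally show ?thesis by (simp only: conj)
  qed
  then have "?z \<in> ZU" by (rule ZU_I[OF uv])
  then have "pu (?z * v) = pu v" using v by (rule pu_cong)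
  then show ?thesis using v by (simp add: mult.assoc unitary_def)
qed

lemma bdry_PG: "unitary u \<Longrightarrow> bdry PG (pu u) = Ad u"
  by (simp add: PG_def Ad_pu)

lemma dom_grp_PG: "dom_grp PG = PU"
  by (simp add: PG_def)

lemma inj_on_bdry_PG: "inj_on (bdry PG) (carrier PU)"
proof (rule inj_onI)
  fix c d assume "c \<in> carrier PU" "d \<in> carrier PU" and e: "bdry PG c = bdry PG d"
  then obtain u v where uv: "unitary u" "unitary v" "c = pu u" "d = pu v"
    unfolding carrier_PU by blast
  with e have "Ad u = Ad v" by (simp add: bdry_PG)
  then have "pu u = pu v" by (rule Ad_eq_imp_pu_eq[OF uv(1,2)])
  with uv show "c = d" by simp
qed

lemma bdry_PG_image: "bdry PG ` carrier PU = Inn"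
  by (simp add: carrier_PU Inn_def image_image bdry_PG cong: image_cong_simp)

lemma injective_crossed_module_PG: "injective_crossed_module Inn Aut (carrier Aut) PG"
proof -
  interpret normal Inn Aut by (rule normal_Inn)
  show ?thesis
  proof (intro injective_crossed_module.intro injective_crossed_module_axioms.intro)
    show "cod_grp PG = Aut\<lparr>carrier := carrier Aut\<rparr>" by (simp add: PG_def Aut_def)
    show "inj_on (bdry PG) (carrier (dom_grp PG))" "bdry PG ` carrier (dom_grp PG) = Inn"
      using inj_on_bdry_PG bdry_PG_image by (simp_all add: dom_grp_PG)
  qed (rule normal_Inn crossed_module_PG subgroup_self subset)+
qed

lemma injective_crossed_module_PG_tr:
  assumes \<tau>: "tracial_state \<tau>"
  shows "injective_crossed_module Inn Aut (carrier (Aut_tr \<tau>)) (PG_tr \<tau>)"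
proof -
  have "Inn \<subseteq> carrier (Aut_tr \<tau>)"
  proof
    fix \<phi> :: "'a \<Rightarrow> 'a" assume "\<phi> \<in> Inn"
    then obtain u where u: "unitary u" "\<phi> = Ad u" by (auto simp: Inn_def)
    have "\<tau> (Ad u a) = \<tau> (star u * (u * a))" for a
      using \<tau> by (simp add: Ad_def tracial_state_def)
    then have "\<tau> \<circ> Ad u = \<tau>" using u(1) by (auto simp: unitary_def simp flip: mult.assoc)
    with u show "\<phi> \<in> carrier (Aut_tr \<tau>)" by (simp add: Aut_tr_def star_automorphism_Ad)
  qed
  moreover have "dom_grp (PG_tr \<tau>) = PU" "bdry (PG_tr \<tau>) = bdry PG"
    by (simp_all add: PG_tr_def dom_grp_PG)
  ultimately show ?thesis
    by (intro injective_crossed_module.intro injective_crossed_module_axioms.intro)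
      (use normal_Inn crossed_module_PG_tr[OF \<tau>] subgroup_Aut_tr inj_on_bdry_PG bdry_PG_image in
        \<open>simp_all add: PG_tr_def Aut_tr_def\<close>)
qed

lemma kernel_subset_Aut:
  assumes "\<kappa> \<in> kernels \<Gamma>" "g \<in> carrier \<Gamma>"
  shows "\<kappa> g \<subseteq> carrier Aut"
proof -
  interpret normal Inn Aut by (rule normal_Inn)
  have "\<kappa> g \<in> rcosets\<^bsub>Aut\<^esub> Inn"
    using assms by (auto simp: kernels_def hom_def Out_def FactGroup_def)
  then show ?thesis by (rule rcosets_carrier[OF group_Aut])
qed

lemma kernels_in_PG:
  "injective_crossed_module.kernels_in Inn Aut (carrier Aut) \<Gamma> = kernels \<Gamma>"
proof -
  interpret P: injective_crossed_module Inn Aut "carrier Aut" PG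
    by (rule injective_crossed_module_PG)
  have "P.kernels_in \<Gamma> = {\<kappa> \<in> kernels \<Gamma>. \<forall>g \<in> carrier \<Gamma>. \<kappa> g \<subseteq> carrier Aut}"
    unfolding P.kernels_in_def kernels_def Out_def ..
  moreover have "\<forall>g \<in> carrier \<Gamma>. \<kappa> g \<subseteq> carrier Aut" if "\<kappa> \<in> kernels \<Gamma>" for \<kappa>
    using kernel_subset_Aut[OF that] by (rule ballI)
  ultimately show ?thesis by blast
qed

lemma kernels_in_PG_tr:
  assumes "tracial_state \<tau>"
  shows "injective_crossed_module.kernels_in Inn Aut (carrier (Aut_tr \<tau>)) \<Gamma> = kernels_tr \<Gamma> \<tau>"
proof -
  interpret T: injective_crossed_module Inn Aut "carrier (Aut_tr \<tau>)" "PG_tr \<tau>"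
    by (rule injective_crossed_module_PG_tr[OF assms])
  have "carrier (Aut_tr \<tau>) = {\<phi> \<in> carrier Aut. \<tau> \<circ> \<phi> = \<tau>}" by (simp add: Aut_tr_def)
  then have "(\<forall>g \<in> carrier \<Gamma>. \<kappa> g \<subseteq> carrier (Aut_tr \<tau>))
      \<longleftrightarrow> (\<forall>g \<in> carrier \<Gamma>. \<forall>\<phi> \<in> \<kappa> g. \<tau> \<circ> \<phi> = \<tau>)" if "\<kappa> \<in> kernels \<Gamma>" for \<kappa>
    using kernel_subset_Aut[OF that] by fast
  moreover have "T.kernels_in \<Gamma> = {\<kappa> \<in> kernels \<Gamma>. \<forall>g \<in> carrier \<Gamma>. \<kappa> g \<subseteq> carrier (Aut_tr \<tau>)}"
    unfolding T.kernels_in_def kernels_def Out_def ..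
  ultimately show ?thesis unfolding kernels_tr_def by (simp only: cong: conj_cong)
qed

lemma conj_in_PG:
  "injective_crossed_module.conj_in Inn Aut (carrier Aut) \<Gamma> = conj_rel \<Gamma>"
  unfolding injective_crossed_module.conj_in_def[OF injective_crossed_module_PG] kernels_in_PG
    conj_rel_def conjugates_def quot_Out_def Out_def ..

lemma conj_in_PG_tr:
  assumes "tracial_state \<tau>"
  shows "injective_crossed_module.conj_in Inn Aut (carrier (Aut_tr \<tau>)) \<Gamma> = conj_rel_tr \<Gamma> \<tau>"
  unfolding injective_crossed_module.conj_in_def[OF injective_crossed_module_PG_tr[OF assms]]
    kernels_in_PG_tr[OF assms] conj_rel_tr_def conjugates_def quot_Out_def Out_def ..

lemma coset_map_Inn: "injective_crossed_module.coset_map Inn Aut \<Gamma> = kernel_of \<Gamma>"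
  unfolding injective_crossed_module.coset_map_def[OF injective_crossed_module_PG]
    kernel_of_def quot_Out_def ..

lemma trivial_kernel_Inn: "(\<lambda>g \<in> carrier \<Gamma>. \<one>\<^bsub>Aut Mod Inn\<^esub>) = trivial_kernel \<Gamma>"
  unfolding trivial_kernel_def Out_def ..

theorem proposition3p8:
  fixes \<Gamma> :: "('g, 'm) monoid_scheme"
    and \<tau> :: "'a::unital_cstar_algebra \<Rightarrow> complex"
  assumes "group \<Gamma>"
    and "separable_space (euclidean :: 'a topology)"
    and "connected (carrier (U_grp :: 'a monoid))"
  shows
    "(let X = (PG :: ('a set, 'a \<Rightarrow> 'a) xmod);
          \<Phi> = induced (conj_rel \<Gamma>) (kernel_of \<Gamma>)
      in (\<forall>c \<in> Z1 \<Gamma> X. kernel_of \<Gamma> c \<in> kernels \<Gamma>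
             \<and> \<Phi> (cohom_rel \<Gamma> X `` {c}) = conj_rel \<Gamma> `` {kernel_of \<Gamma> c})
         \<and> bij_betw \<Phi> (H1 \<Gamma> X) (kernels \<Gamma> // conj_rel \<Gamma>)
         \<and> \<Phi> (cohom_rel \<Gamma> X `` {trivial_cocycle \<Gamma> X}) = conj_rel \<Gamma> `` {trivial_kernel \<Gamma>}
         \<and> (\<forall>(\<Delta> :: ('d, 'n) monoid_scheme) f. group \<Delta> \<longrightarrow> f \<in> hom \<Delta> \<Gamma> \<longrightarrow>
              (\<forall>x \<in> H1 \<Gamma> X.
                 induced (conj_rel \<Delta>) (kernel_of \<Delta>)
                     (induced (cohom_rel \<Delta> X) (pull_cocycle \<Delta> f) x)
                   = induced (conj_rel \<Delta>) (pull_map \<Delta> f) (\<Phi> x))))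
     \<and>
     (tracial_state \<tau> \<longrightarrow>
     (let X = PG_tr \<tau>;
          \<Phi> = induced (conj_rel_tr \<Gamma> \<tau>) (kernel_of \<Gamma>)
      in (\<forall>c \<in> Z1 \<Gamma> X. kernel_of \<Gamma> c \<in> kernels_tr \<Gamma> \<tau>
             \<and> \<Phi> (cohom_rel \<Gamma> X `` {c}) = conj_rel_tr \<Gamma> \<tau> `` {kernel_of \<Gamma> c})
         \<and> bij_betw \<Phi> (H1 \<Gamma> X) (kernels_tr \<Gamma> \<tau> // conj_rel_tr \<Gamma> \<tau>)
         \<and> \<Phi> (cohom_rel \<Gamma> X `` {trivial_cocycle \<Gamma> X})
             = conj_rel_tr \<Gamma> \<tau> `` {trivial_kernel \<Gamma>}
         \<and> (\<forall>(\<Delta> :: ('d, 'n) monoid_scheme) f. group \<Delta> \<longrightarrow> f \<in> hom \<Delta> \<Gamma> \<longrightarrow>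
              (\<forall>x \<in> H1 \<Gamma> X.
                 induced (conj_rel_tr \<Delta> \<tau>) (kernel_of \<Delta>)
                     (induced (cohom_rel \<Delta> X) (pull_cocycle \<Delta> f) x)
                   = induced (conj_rel_tr \<Delta> \<tau>) (pull_map \<Delta> f) (\<Phi> x)))))"
proof ((rule conjI; (rule impI)?), goal_cases)
  case 1
  show ?case
    using injective_crossed_module.H1_isomorphism[OF injective_crossed_module_PG assms(1)]
    unfolding conj_in_PG kernels_in_PG coset_map_Inn trivial_kernel_Inn Let_def .
next
  case 2
  show ?case
    using injective_crossed_module.H1_isomorphism[OF injective_crossed_module_PG_tr[OF 2] assms(1)]
    unfolding conj_in_PG_tr[OF 2] kernels_in_PG_tr[OF 2] coset_map_Inn trivial_kernel_Inn Let_def .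
qed

end
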